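(* Let $n\ge2$ and $\gamma\in(0,\tfrac n2)$. Consider the linearized equation for functions $v=v(t)$, $t\in\mathbb R$, $$P^0_\gamma v=c_{n,\gamma}\,\tfrac{n+2\gamma}{n-2\gamma}\,v ,$$ i.e. the projection over the eigenspace $k=0$ (constant eigenfunctions on $\mathbb S^{n-1}$) of the linearization around $v_1\equiv1$ of $P_\gamma^{g_0}(v)=c_{n,\gamma}v^{\frac{n+2\gamma}{n-2\gamma}}$ on $\mathbb R\times\mathbb S^{n-1}$. Then the equation $$\frac{\left|\Gamma\left(\tfrac n4+\tfrac\gamma2+\tfrac{\sqrt{\lambda}}{2}i\right)\right|^2}{\left|\Gamma\left(\tfrac n4-\tfrac\gamma2+\tfrac{\sqrt{\lambda}}{2}i\right)\right|^2}=\frac{n+2\gamma}{n-2\gamma}\,\frac{\left|\Gamma\left(\frac12\left(\frac n2+\gamma\right)\right)\right|^2}{\left|\Gamma\left(\frac12\left(\frac n2-\gamma\right)\right)\right|^2}$$ has a unique positive solution $\lambda=\lambda_\gamma$, and the linearized equation has (not identically zero) periodic solutions $v(t)$ with period $L_\gamma=\frac{2\pi}{\sqrt{\lambda_\gamma}}$. In addition, if $n\geq 3$, $$\lim_{\gamma\to1}L_\gamma=L_1,\qquad\text{where } L_1=\frac{2\pi}{\sqrt{n-2}}.$$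
   Context: The fractional Laplacian $(-\Delta)^\gamma$ on $\mathbb R^n$ is the Fourier multiplier with symbol $|\xi|^{2\gamma}$. With $r=e^{-t}$ and $g_0=dt^2+g_{\mathbb S^{n-1}}$, so that $|dx|^2=e^{-2t}g_0$ on $\mathbb R^n\setminus\{0\}\cong\mathbb R\times\mathbb S^{n-1}$, the conformal fractional Laplacian $P_\gamma^{g_0}$ on $\mathbb R\times\mathbb S^{n-1}$ is given, for $\phi\in C_0^\infty(\mathbb R\times\mathbb S^{n-1})$, by $$(P_\gamma^{g_0}\phi)(t,\theta)=r^{\frac{n+2\gamma}{2}}\,\big((-\Delta)^\gamma w\big)(r\theta),\qquad w(r\theta)=r^{-\frac{n-2\gamma}{2}}\phi(-\ln r,\theta),\qquad r=e^{-t}.$$ $P^0_\gamma$ denotes the restriction of $P^{g_0}_\gamma$ to functions depending only on $t$ (it maps such functions to functions of $t$ only). For bounded smooth $v:\mathbb R\to\mathbb R$, $P^0_\gamma v$ is understood by duality (the operator being symmetric): $\int_{\mathbb R}(P^0_\gamma v)\,\phi\,dt=\int_{\mathbb R}v\,(P^0_\gamma\phi)\,dt$ for all $\phi\in C_0^\infty(\mathbb R)$. The constant is $$c_{n,\gamma}=2^{2\gamma}\left(\frac{\Gamma(\frac12(\frac n2+\gamma))}{\Gamma(\frac12(\frac n2-\gamma))}\right)^2.$$ *)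

theory Defs
  imports "HOL-Analysis.Analysis"
begin

subsection \<open>The fractional Laplacian\<close>

definition fourier :: "(real ^ 'n \<Rightarrow> complex) \<Rightarrow> real ^ 'n \<Rightarrow> complex" where
  "fourier f \<xi> = (LINT x|lborel. f x * cis (- (x \<bullet> \<xi>)))"

text \<open>
  The Fourier multiplier with symbol \<open>|\<xi>|\<close> to the power \<open>2\<gamma>\<close>, as an absolutely convergent
  inverse Fourier integral. This is the intended operator when \<open>f\<close> is a Schwartz function;
  it is applied below only to smooth functions with compact support in the punctured space.
\<close>

definition frac_laplacian :: "real \<Rightarrow> (real ^ 'n \<Rightarrow> complex) \<Rightarrow> real ^ 'n \<Rightarrow> complex" where
  "frac_laplacian \<gamma> f x =
     (LINT \<xi>|lborel. of_real (norm \<xi> powr (2 * \<gamma>)) * fourier f \<xi> * cis (x \<bullet> \<xi>))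
       / of_real ((2 * pi) ^ CARD('n))"


subsection \<open>The conformal fractional Laplacian on the cylinder\<close>

text \<open>
  Functions on the cylinder are functions of \<open>t\<close> and of \<open>\<theta>\<close> in the unit sphere
  \<open>sphere 0 1\<close>; values at other vectors \<open>\<theta>\<close> play no role.
  At \<open>x = 0\<close> the value of \<open>cyl_to_space \<gamma> \<phi>\<close> is \<open>0\<close>, because \<open>0 powr a = 0\<close>: for \<open>\<phi>\<close> of compact
  support this is the smooth extension across the origin.
\<close>

definition cyl_to_space :: "real \<Rightarrow> (real \<Rightarrow> real ^ 'n \<Rightarrow> complex) \<Rightarrow> real ^ 'n \<Rightarrow> complex" where
  "cyl_to_space \<gamma> \<phi> x =
     of_real (norm x powr (- ((real CARD('n) - 2 * \<gamma>) / 2))) * \<phi> (- ln (norm x)) (x /\<^sub>R norm x)"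

definition P_cyl ::
  "real \<Rightarrow> (real \<Rightarrow> real ^ 'n \<Rightarrow> complex) \<Rightarrow> real \<Rightarrow> real ^ 'n \<Rightarrow> complex" where
  "P_cyl \<gamma> \<phi> t \<theta> =
     of_real (exp (- t) powr ((real CARD('n) + 2 * \<gamma>) / 2))
       * frac_laplacian \<gamma> (cyl_to_space \<gamma> \<phi>) (exp (- t) *\<^sub>R \<theta>)"

text \<open>
  The restriction of \<open>P_cyl\<close> to real functions of \<open>t\<close> alone: the real number that is the value of
  \<open>P_cyl\<close> at \<open>(t, \<theta>)\<close> for every \<open>\<theta>\<close> on the sphere. The type argument carries the dimension.
\<close>

definition P0 :: "'n::finite itself \<Rightarrow> real \<Rightarrow> (real \<Rightarrow> real) \<Rightarrow> real \<Rightarrow> real" where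
  "P0 _ \<gamma> \<phi> t =
     (THE u. \<forall>\<theta> :: real ^ 'n \<in> sphere 0 1.
        P_cyl \<gamma> (\<lambda>s _. complex_of_real (\<phi> s)) t \<theta> = complex_of_real u)"


subsection \<open>Extension by duality and the linearized equation\<close>

definition smooth :: "(real \<Rightarrow> real) \<Rightarrow> bool" where
  "smooth f \<longleftrightarrow> (\<forall>k. (deriv ^^ k) f differentiable_on UNIV)"

definition test_function :: "(real \<Rightarrow> real) \<Rightarrow> bool" where
  "test_function \<phi> \<longleftrightarrow> smooth \<phi> \<and> compact (closure {t. \<phi> t \<noteq> 0})"

text \<open>
  \<open>P0_dual T \<gamma> v u\<close> says that \<open>u\<close> is \<open>P0\<close> applied to the bounded smooth function \<open>v\<close>, by duality
  (the operator being symmetric). Integrability is demanded explicitly because the integral of a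
  function that is not integrable is \<open>0\<close> by convention.
\<close>

definition P0_dual :: "'n::finite itself \<Rightarrow> real \<Rightarrow> (real \<Rightarrow> real) \<Rightarrow> (real \<Rightarrow> real) \<Rightarrow> bool" where
  "P0_dual T \<gamma> v u \<longleftrightarrow>
     (\<forall>\<phi>. test_function \<phi> \<longrightarrow>
        integrable lborel (\<lambda>t. u t * \<phi> t) \<and>
        integrable lborel (\<lambda>t. v t * P0 T \<gamma> \<phi> t) \<and>
        (LINT t|lborel. u t * \<phi> t) = (LINT t|lborel. v t * P0 T \<gamma> \<phi> t))"

definition c_const :: "nat \<Rightarrow> real \<Rightarrow> real" where
  "c_const n \<gamma> =
     2 powr (2 * \<gamma>) * (Gamma ((real n / 2 + \<gamma>) / 2) / Gamma ((real n / 2 - \<gamma>) / 2))\<^sup>2"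

text \<open>
  The linearization at \<open>v = 1\<close> of \<open>P v = c v\<close> to the power \<open>(n + 2\<gamma>) / (n - 2\<gamma>)\<close>, on functions of
  \<open>t\<close> alone.
\<close>

definition linearized_solution :: "'n::finite itself \<Rightarrow> real \<Rightarrow> (real \<Rightarrow> real) \<Rightarrow> bool" where
  "linearized_solution T \<gamma> v \<longleftrightarrow>
     smooth v \<and> bounded (range v) \<and>
     P0_dual T \<gamma> v
       (\<lambda>t. c_const CARD('n) \<gamma>
             * ((real CARD('n) + 2 * \<gamma>) / (real CARD('n) - 2 * \<gamma>)) * v t)"


subsection \<open>The equation for the eigenvalue and the period\<close>

definition gamma_equation :: "nat \<Rightarrow> real \<Rightarrow> real \<Rightarrow> bool" where
  "gamma_equation n \<gamma> l \<longleftrightarrow>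
     (cmod (Gamma (Complex (real n / 4 + \<gamma> / 2) (sqrt l / 2))))\<^sup>2
       / (cmod (Gamma (Complex (real n / 4 - \<gamma> / 2) (sqrt l / 2))))\<^sup>2
     = (real n + 2 * \<gamma>) / (real n - 2 * \<gamma>)
       * (\<bar>Gamma ((real n / 2 + \<gamma>) / 2)\<bar>\<^sup>2 / \<bar>Gamma ((real n / 2 - \<gamma>) / 2)\<bar>\<^sup>2)"

definition lambda_sol :: "nat \<Rightarrow> real \<Rightarrow> real" where
  "lambda_sol n \<gamma> = (THE l. 0 < l \<and> gamma_equation n \<gamma> l)"

definition period :: "nat \<Rightarrow> real \<Rightarrow> real" where
  "period n \<gamma> = 2 * pi / sqrt (lambda_sol n \<gamma>)"

end

theory Submission
  imports Defs "HOL-Probability.Characteristic_Functions" "HOL-Real_Asymp.Real_Asymp"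
begin

text \<open>
  On functions of \<open>t\<close> alone the operator \<open>P0\<close> is a Fourier multiplier on the line. Its symbol at
  the frequency \<open>\<mu>\<close> is
    \<open>2 powr (2\<gamma>) * |\<Gamma>(n/4 + \<gamma>/2 + i\<mu>/2)|\<^sup>2 / |\<Gamma>(n/4 - \<gamma>/2 + i\<mu>/2)|\<^sup>2\<close>,
  and the constant of the linearized equation is \<open>(n + 2\<gamma>) / (n - 2\<gamma>)\<close> times the value of this
  symbol at \<open>\<mu> = 0\<close>. Hence \<open>cos (\<mu> t)\<close> solves the linearized equation as soon as \<open>\<mu> = sqrt \<lambda>\<close>
  for a root \<open>\<lambda>\<close> of the equation with Gamma functions.

  \<^bold>\<open>The root.\<close> Put \<open>p = n/4 + \<gamma>/2\<close> and \<open>q = n/4 - \<gamma>/2\<close>, so \<open>0 < q < p\<close>. By Euler's product the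
  quotient \<open>|\<Gamma>(p + is)|\<^sup>2 / |\<Gamma>(q + is)|\<^sup>2\<close> is, up to a factor independent of \<open>s\<close>, the limit of the
  products of \<open>((q + k)\<^sup>2 + s\<^sup>2) / ((p + k)\<^sup>2 + s\<^sup>2)\<close>, and every factor increases in \<open>s\<close>. So the
  quotient grows at least as fast as its factor \<open>k = 0\<close> (\<open>gamma_ratio_growth\<close>). This gives strict
  monotonicity, hence uniqueness. It also gives existence, because between \<open>s = 0\<close> and infinity the
  factor \<open>k = 0\<close> alone grows by \<open>(p/q)\<^sup>2\<close>, while the equation asks for a growth by \<open>p/q\<close>. The root
  is thus a strict sign change of a function that is continuous in \<open>\<gamma>\<close>, so it depends
  continuously on \<open>\<gamma>\<close>; at \<open>\<gamma> = 1\<close> the functional equation of \<open>\<Gamma>\<close> reduces the equation to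
  \<open>q\<^sup>2 + \<lambda>/4 = q (q + 1)\<close>, and \<open>\<lambda> = n - 2\<close>.

  \<^bold>\<open>The symbol.\<close> A test function \<open>\<phi>\<close> on the line corresponds to the radial function
  \<open>w x = |x| powr (\<gamma> - n/2) * \<phi> (- ln |x|)\<close>. In polar coordinates the Fourier integral of \<open>P0 \<phi>\<close>
  at \<open>\<mu>\<close> becomes the integral of \<open>|x| powr (-z)\<close> against the fractional Laplacian of \<open>w\<close>, with
  \<open>z = n/2 - \<gamma> + i\<mu>\<close>. The tool is \<open>integral_npow_fourier\<close>: writing \<open>|x| powr (-z)\<close> as a superposition
  of Gaussians moves it through a Fourier transform, where it becomes a multiple of
  \<open>|y| powr (z - n)\<close> with an explicit quotient of Gamma functions. Using this once for the outer
  and once for the inner Fourier transform in the definition of the fractional Laplacian produces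
  the symbol (\<open>integral_npow_frac_laplacian\<close>, \<open>P0_Fourier_multiplier\<close>).

  \<^bold>\<open>Decay.\<close> These manipulations require absolute convergence. The Fourier transform of \<open>w\<close> decays
  rapidly because the Laplacian maps radial functions with a smooth compactly supported profile to
  functions of the same kind. For the fractional Laplacian of \<open>w\<close>
  the bound \<open>|x| powr (- n - 2\<gamma>)\<close> at infinity suffices. To obtain it one picks \<open>m\<close> with \<open>0 < 2(m - \<gamma>) < n\<close>; then the tool above, applied to
  a translate, presents the fractional Laplacian of \<open>w\<close> as the Riesz potential of order
  \<open>2(m - \<gamma>)\<close> of the \<open>m\<close>-th power of the Laplacian of \<open>w\<close>, and for large \<open>x\<close> Green's formula moves these
  Laplacians onto the kernel. The Riesz potential also shows that the result is real and
  invariant under rotations, so the value of \<open>P0\<close> is well defined.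
\<close>

section \<open>Monotonicity of the Gamma quotient\<close>

definition gamma_ratio :: "real \<Rightarrow> real \<Rightarrow> real \<Rightarrow> real" where
  "gamma_ratio p q s = (cmod (Gamma (Complex p s)))\<^sup>2 / (cmod (Gamma (Complex q s)))\<^sup>2"

lemma Complex_not_nonpos_Int: "0 < x \<Longrightarrow> Complex x s \<notin> \<int>\<^sub>\<le>\<^sub>0"
  by (auto simp: complex_eq_iff elim!: nonpos_Ints_cases)

lemma Gamma_Complex_nonzero: "0 < x \<Longrightarrow> Gamma (Complex x s) \<noteq> 0"
  by (simp add: Gamma_eq_zero_iff Complex_not_nonpos_Int)

text \<open>
  Cleared of denominators, this says that from \<open>s\<close> to \<open>s'\<close> the quotient grows at least as much as the
  single factor \<open>(q\<^sup>2 + s\<^sup>2) / (p\<^sup>2 + s\<^sup>2)\<close> of its product expansion, since the other factors increase as well.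
\<close>

lemma gamma_ratio_growth:
  fixes p q s s' :: real
  assumes "0 < q" "q \<le> p" "0 \<le> s" "s \<le> s'"
  shows "gamma_ratio p q s * ((q\<^sup>2 + s'\<^sup>2) / (p\<^sup>2 + s'\<^sup>2))
           \<le> gamma_ratio p q s' * ((q\<^sup>2 + s\<^sup>2) / (p\<^sup>2 + s\<^sup>2))"
proof -
  define f where "f k s = ((q + real k)\<^sup>2 + s\<^sup>2) / ((p + real k)\<^sup>2 + s\<^sup>2)" for k :: nat and s :: real
  define c where "c N = (exp ((p - q) * ln (real N)))\<^sup>2" for N :: nat
  \<comment> \<open>The partial products of Euler's limit formula; \<open>c N\<close> is the only other part, and it does not involve \<open>s\<close>.\<close>
  define R where "R N s = (\<Prod>k<Suc N. f k s) * c N" for N s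
  have f_pos: "0 < f k s" for k s
    using assms by (auto simp: f_def intro!: divide_pos_pos add_pos_nonneg)
  have f_mono: "f k s \<le> f k s'" for k
  proof -
    have 1: "(q + real k)\<^sup>2 \<le> (p + real k)\<^sup>2" and 2: "s\<^sup>2 \<le> s'\<^sup>2"
      using assms by (auto intro!: power_mono)
    have 3: "0 < (p + real k)\<^sup>2 + t\<^sup>2" for t
      using assms by (auto intro!: add_pos_nonneg)
    have "0 \<le> ((p + real k)\<^sup>2 - (q + real k)\<^sup>2) * (s'\<^sup>2 - s\<^sup>2)"
      using 1 2 by (intro mult_nonneg_nonneg) auto
    then show ?thesis unfolding f_def
      using 3[of s] 3[of s'] by (simp add: divide_simps) (simp add: algebra_simps)
  qed
  have norm_series: "(cmod (rGamma_series (Complex x s) N))\<^sup>2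
      = (\<Prod>k<Suc N. (x + real k)\<^sup>2 + s\<^sup>2) / (fact N * exp (x * ln (real N)))\<^sup>2" for x s N
  proof -
    have "cmod (pochhammer (Complex x s) (Suc N)) = (\<Prod>k<Suc N. cmod (Complex x s + of_nat k))"
      by (simp add: pochhammer_prod prod_norm atLeast0LessThan)
    moreover have "(cmod (Complex x s + of_nat k))\<^sup>2 = (x + real k)\<^sup>2 + s\<^sup>2" for k
      by (simp add: cmod_power2)
    ultimately have "(cmod (pochhammer (Complex x s) (Suc N)))\<^sup>2 = (\<Prod>k<Suc N. (x + real k)\<^sup>2 + s\<^sup>2)"
      by (simp only: prod_power_distrib)
    then show ?thesis
      by (simp add: rGamma_series_def norm_divide norm_mult power_divide power_mult_distrib
          del: prod.lessThan_Suc)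
  qed
  have lim: "(\<lambda>N. R N s) \<longlonglongrightarrow> gamma_ratio p q s" for s
  proof -
    have "(\<lambda>N. (cmod (rGamma_series (Complex q s) N))\<^sup>2 / (cmod (rGamma_series (Complex p s) N))\<^sup>2)
       \<longlonglongrightarrow> (cmod (rGamma (Complex q s)))\<^sup>2 / (cmod (rGamma (Complex p s)))\<^sup>2"
      using Gamma_Complex_nonzero[of p s] assms
      by (intro tendsto_intros) (auto simp: rGamma_inverse_Gamma)
    moreover have "(cmod (rGamma_series (Complex q s) N))\<^sup>2 / (cmod (rGamma_series (Complex p s) N))\<^sup>2
        = R N s" for N
      unfolding norm_series R_def f_def c_def prod_dividef
      by (simp add: power_mult_distrib left_diff_distrib exp_diff power_divide field_simps
          del: prod.lessThan_Suc)
    ultimately show ?thesis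
      by (simp add: gamma_ratio_def rGamma_inverse_Gamma norm_inverse power_inverse divide_inverse
          mult.commute)
  qed
  have R_le: "R N s * f 0 s' \<le> R N s' * f 0 s" for N
  proof -
    have "(\<Prod>k<N. f (Suc k) s) \<le> (\<Prod>k<N. f (Suc k) s')"
      by (intro prod_mono) (auto intro: f_mono less_imp_le[OF f_pos])
    then have "(f 0 s * f 0 s' * c N) * (\<Prod>k<N. f (Suc k) s)
        \<le> (f 0 s * f 0 s' * c N) * (\<Prod>k<N. f (Suc k) s')"
      by (intro mult_left_mono) (auto simp: c_def less_imp_le[OF f_pos])
    then show ?thesis
      unfolding R_def prod.lessThan_Suc_shift by (simp add: mult_ac)
  qed
  have "gamma_ratio p q s * f 0 s' \<le> gamma_ratio p q s' * f 0 s"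
    by (rule LIMSEQ_le[OF tendsto_mult[OF lim tendsto_const] tendsto_mult[OF lim tendsto_const]])
       (use R_le in auto)
  then show ?thesis by (simp add: f_def)
qed

lemma gamma_ratio_pos: "0 < q \<Longrightarrow> 0 < p \<Longrightarrow> 0 < gamma_ratio p q s"
  by (simp add: gamma_ratio_def Gamma_Complex_nonzero)

lemma gamma_ratio_strict_mono:
  assumes "0 < q" "q < p" "0 \<le> s" "s < s'"
  shows "gamma_ratio p q s < gamma_ratio p q s'"
proof -
  have sq: "s\<^sup>2 < s'\<^sup>2" "q\<^sup>2 < p\<^sup>2"
    using assms by (auto intro!: power_strict_mono)
  have pos: "0 < p\<^sup>2 + t\<^sup>2" "0 < q\<^sup>2 + t\<^sup>2" for t
    using assms by (auto intro!: add_pos_nonneg)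
  have "0 < (p\<^sup>2 - q\<^sup>2) * (s'\<^sup>2 - s\<^sup>2)"
    using sq by simp
  then have "(q\<^sup>2 + s\<^sup>2) / (p\<^sup>2 + s\<^sup>2) < (q\<^sup>2 + s'\<^sup>2) / (p\<^sup>2 + s'\<^sup>2)"
    using pos by (simp add: divide_simps) (simp add: algebra_simps)
  then have "gamma_ratio p q s * ((q\<^sup>2 + s\<^sup>2) / (p\<^sup>2 + s\<^sup>2))
      < gamma_ratio p q s * ((q\<^sup>2 + s'\<^sup>2) / (p\<^sup>2 + s'\<^sup>2))"
    using gamma_ratio_pos assms by (intro mult_strict_left_mono) auto
  also have "\<dots> \<le> gamma_ratio p q s' * ((q\<^sup>2 + s\<^sup>2) / (p\<^sup>2 + s\<^sup>2))"
    using assms by (intro gamma_ratio_growth) auto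
  finally show ?thesis
    by (rule mult_right_less_imp_less) (use pos[of s] in auto)
qed

lemma isCont_gamma_ratio:
  assumes "isCont p x" "isCont q x" "isCont s x" and "0 < p x" "0 < q x"
  shows "isCont (\<lambda>x. gamma_ratio (p x) (q x) (s x)) x"
proof -
  have [continuous_intros]: "isCont (\<lambda>x. Complex (u x) (v x)) x"
    if "isCont u x" "isCont v x" for u v
    using that unfolding isCont_def by (rule tendsto_Complex)
  show ?thesis
    unfolding gamma_ratio_def
    using assms by (intro continuous_intros) (auto simp: Complex_not_nonpos_Int Gamma_Complex_nonzero)
qed

text \<open>
  The factor of index \<open>0\<close> tends to \<open>1\<close> from the value \<open>(q/p)\<^sup>2\<close>, so in the limit the quotient has grown by
  at least \<open>(p/q)\<^sup>2\<close>, which is more than \<open>p/q\<close>.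
\<close>

lemma gamma_ratio_exceeds:
  assumes "0 < q" "q < p"
  shows "\<exists>s>0. p / q * gamma_ratio p q 0 < gamma_ratio p q s"
proof -
  have "((\<lambda>s. ((q\<^sup>2 + s\<^sup>2) / (p\<^sup>2 + s\<^sup>2)) * (p\<^sup>2 / q\<^sup>2)) \<longlongrightarrow> p\<^sup>2 / q\<^sup>2) at_top"
    using assms by real_asymp
  moreover have "p / q < p\<^sup>2 / q\<^sup>2"
    using assms by (simp add: divide_simps power2_eq_square)
  ultimately have "\<forall>\<^sub>F s in at_top. p / q < ((q\<^sup>2 + s\<^sup>2) / (p\<^sup>2 + s\<^sup>2)) * (p\<^sup>2 / q\<^sup>2)"
    by (rule order_tendstoD(1))
  then obtain s where s: "p / q < ((q\<^sup>2 + s\<^sup>2) / (p\<^sup>2 + s\<^sup>2)) * (p\<^sup>2 / q\<^sup>2)" "0 < s"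
    by (metis (no_types, lifting) eventually_at_top_dense eventually_conj eventually_gt_at_top
        eventually_happens' trivial_limit_at_top_linorder)
  have "gamma_ratio p q 0 * (p / q) < gamma_ratio p q 0 * (((q\<^sup>2 + s\<^sup>2) / (p\<^sup>2 + s\<^sup>2)) * (p\<^sup>2 / q\<^sup>2))"
    using s assms by (intro mult_strict_left_mono gamma_ratio_pos) auto
  also have "\<dots> \<le> gamma_ratio p q s"
  proof -
    have "gamma_ratio p q 0 * ((q\<^sup>2 + s\<^sup>2) / (p\<^sup>2 + s\<^sup>2)) \<le> gamma_ratio p q s * (q\<^sup>2 / p\<^sup>2)"
      using gamma_ratio_growth[of q p 0 s] s assms by simp
    then have "gamma_ratio p q 0 * ((q\<^sup>2 + s\<^sup>2) / (p\<^sup>2 + s\<^sup>2)) * (p\<^sup>2 / q\<^sup>2)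
        \<le> gamma_ratio p q s * (q\<^sup>2 / p\<^sup>2) * (p\<^sup>2 / q\<^sup>2)"
      by (rule mult_right_mono) simp
    then show ?thesis
      using assms by (simp add: mult.assoc)
  qed
  finally show ?thesis
    using s by (auto simp: mult.commute)
qed

lemma ex1_gamma_ratio_eq:
  assumes "0 < q" "q < p"
  shows "\<exists>!l. 0 < l \<and> gamma_ratio p q (sqrt l / 2) = p / q * gamma_ratio p q 0"
proof -
  let ?g = "\<lambda>l. gamma_ratio p q (sqrt l / 2)"
  let ?c = "p / q * gamma_ratio p q 0"
  obtain s where s: "0 < s" "?c < gamma_ratio p q s"
    using gamma_ratio_exceeds[OF assms] by auto
  have "?g 0 < ?c"
    using assms gamma_ratio_pos[of q p 0] by (simp add: field_simps)
  moreover have "?c < ?g (4 * s\<^sup>2)"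
    using s by (simp add: real_sqrt_mult)
  moreover have "isCont ?g l" for l
    by (rule isCont_gamma_ratio) (use assms in \<open>auto intro!: continuous_intros\<close>)
  ultimately obtain l where l: "0 \<le> l" "?g l = ?c"
    using IVT[of ?g 0 ?c "4 * s\<^sup>2"] s by auto
  then have "0 < l"
    using \<open>?g 0 < ?c\<close> by (cases "l = 0") auto
  moreover have "l = l'" if "0 < l'" "?g l' = ?c" for l'
    using gamma_ratio_strict_mono[of q p "sqrt l / 2" "sqrt l' / 2"]
      gamma_ratio_strict_mono[of q p "sqrt l' / 2" "sqrt l / 2"] that l assms
    by (cases l l' rule: linorder_cases) auto
  ultimately show ?thesis using l by blast
qed

section \<open>The root of the characteristic equation and the period\<close>

text \<open>
  Since \<open>(n + 2\<gamma>) / (n - 2\<gamma>) = p / q\<close> for \<open>p = n/4 + \<gamma>/2\<close> and \<open>q = n/4 - \<gamma>/2\<close>, the equation depends on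
  \<open>p\<close> and \<open>q\<close> only.
\<close>

lemma gamma_equation_iff:
  "gamma_equation n \<gamma> l \<longleftrightarrow>
     gamma_ratio (real n / 4 + \<gamma> / 2) (real n / 4 - \<gamma> / 2) (sqrt l / 2)
     = (real n / 4 + \<gamma> / 2) / (real n / 4 - \<gamma> / 2)
       * gamma_ratio (real n / 4 + \<gamma> / 2) (real n / 4 - \<gamma> / 2) 0"
proof -
  have eq: "(real n / 2 + x) / 2 = real n / 4 + x / 2" "(real n / 2 - x) / 2 = real n / 4 - x / 2" for x
    by simp_all
  have "(real n + 2 * \<gamma>) / (real n - 2 * \<gamma>) = (real n / 4 + \<gamma> / 2) / (real n / 4 - \<gamma> / 2)"
    by (cases "real n = 2 * \<gamma>") (simp_all add: field_simps)
  moreover have "cmod (Gamma (Complex x 0)) = \<bar>Gamma x\<bar>" for x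
    using Gamma_complex_of_real[of x] by (simp flip: complex_of_real_def)
  ultimately show ?thesis
    unfolding gamma_equation_def gamma_ratio_def eq by presburger
qed

lemma ex1_gamma_equation:
  assumes "0 < \<gamma>" "\<gamma> < real n / 2"
  shows "\<exists>!l. 0 < l \<and> gamma_equation n \<gamma> l"
  unfolding gamma_equation_iff by (rule ex1_gamma_ratio_eq) (use assms in auto)

lemma lambda_sol:
  assumes "0 < \<gamma>" "\<gamma> < real n / 2"
  shows "0 < lambda_sol n \<gamma>" "gamma_equation n \<gamma> (lambda_sol n \<gamma>)"
  using theI'[OF ex1_gamma_equation[OF assms]] by (auto simp: lambda_sol_def)

lemma lambda_sol_eqI:
  assumes "0 < \<gamma>" "\<gamma> < real n / 2" "0 < l" "gamma_equation n \<gamma> l"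
  shows "lambda_sol n \<gamma> = l"
  using ex1_gamma_equation[OF assms(1,2)] lambda_sol[OF assms(1,2)] assms(3,4) by blast

text \<open>
  The difference of the two sides of the equation. Its sign locates \<open>l\<close> relative to the root, and for
  fixed \<open>l\<close> it is continuous in \<open>\<gamma>\<close>; together this makes the root continuous in \<open>\<gamma>\<close>.
\<close>

definition gamma_excess :: "nat \<Rightarrow> real \<Rightarrow> real \<Rightarrow> real" where
  "gamma_excess n \<gamma> l = gamma_ratio (real n / 4 + \<gamma> / 2) (real n / 4 - \<gamma> / 2) (sqrt l / 2)
     - (real n / 4 + \<gamma> / 2) / (real n / 4 - \<gamma> / 2)
       * gamma_ratio (real n / 4 + \<gamma> / 2) (real n / 4 - \<gamma> / 2) 0"

lemma gamma_excess_less_iff: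
  assumes "0 < \<gamma>" "\<gamma> < real n / 2" "0 \<le> l"
  shows "gamma_excess n \<gamma> l < 0 \<longleftrightarrow> l < lambda_sol n \<gamma>"
    and "gamma_excess n \<gamma> l > 0 \<longleftrightarrow> l > lambda_sol n \<gamma>"
proof -
  let ?p = "real n / 4 + \<gamma> / 2" and ?q = "real n / 4 - \<gamma> / 2"
  have *: "gamma_excess n \<gamma> (lambda_sol n \<gamma>) = 0"
    using lambda_sol[OF assms(1,2)] by (simp add: gamma_excess_def gamma_equation_iff)
  have mono: "gamma_excess n \<gamma> a < gamma_excess n \<gamma> b" if "0 \<le> a" "a < b" for a b
    unfolding gamma_excess_def
    using gamma_ratio_strict_mono[of ?q ?p "sqrt a / 2" "sqrt b / 2"] that assms by auto
  note m = mono[of l "lambda_sol n \<gamma>"] mono[of "lambda_sol n \<gamma>" l]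
  show "gamma_excess n \<gamma> l < 0 \<longleftrightarrow> l < lambda_sol n \<gamma>"
    and "gamma_excess n \<gamma> l > 0 \<longleftrightarrow> l > lambda_sol n \<gamma>"
    using m * lambda_sol(1)[OF assms(1,2)] assms(3)
    by (cases l "lambda_sol n \<gamma>" rule: linorder_cases; force)+
qed

lemma isCont_gamma_excess:
  assumes "0 < \<gamma>" "\<gamma> < real n / 2"
  shows "isCont (\<lambda>\<gamma>. gamma_excess n \<gamma> l) \<gamma>"
  unfolding gamma_excess_def
  by (intro continuous_intros isCont_gamma_ratio) (use assms in auto)

lemma isCont_lambda_sol:
  assumes "0 < \<gamma>" "\<gamma> < real n / 2"
  shows "isCont (lambda_sol n) \<gamma>"
  unfolding isCont_def
proof (rule order_tendstoI)
  have dom: "\<forall>\<^sub>F x in at \<gamma>. 0 < x \<and> x < real n / 2"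
    using assms eventually_at_in_open'[of "{0<..<real n / 2}" \<gamma>] by simp
  have exc: "((\<lambda>x. gamma_excess n x l) \<longlongrightarrow> gamma_excess n \<gamma> l) (at \<gamma>)" for l
    using isCont_gamma_excess[OF assms] by (simp add: isCont_def)
  {
    fix l assume l: "l < lambda_sol n \<gamma>"
    show "\<forall>\<^sub>F x in at \<gamma>. l < lambda_sol n x"
    proof (cases "0 \<le> l")
      case True
      then have "gamma_excess n \<gamma> l < 0"
        using l assms gamma_excess_less_iff by blast
      from order_tendstoD(2)[OF exc this] dom show ?thesis
        by eventually_elim (use True gamma_excess_less_iff in blast)
    next
      case False
      from dom show ?thesis
        by eventually_elim (use False lambda_sol(1) in force)
    qed
  next
    fix l assume l: "lambda_sol n \<gamma> < l"
    then have "0 \<le> l" using lambda_sol(1)[OF assms] by simp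
    then have "gamma_excess n \<gamma> l > 0"
      using l assms gamma_excess_less_iff by blast
    from order_tendstoD(1)[OF exc this] dom show "\<forall>\<^sub>F x in at \<gamma>. lambda_sol n x < l"
      by eventually_elim (use \<open>0 \<le> l\<close> gamma_excess_less_iff in blast)
  }
qed

text \<open>
  For \<open>\<gamma> = 1\<close> the two arguments differ by \<open>1\<close>, and \<open>\<Gamma>(q + 1 + is) = (q + is) \<Gamma>(q + is)\<close> turns the quotient
  into \<open>q\<^sup>2 + s\<^sup>2\<close>.
\<close>

lemma lambda_sol_1:
  assumes "3 \<le> n"
  shows "lambda_sol n 1 = real n - 2"
proof (rule lambda_sol_eqI)
  define q where "q = real n / 4 - 1 / 2"
  have q: "0 < q" and n: "real n = 4 * q + 2" using assms by (auto simp: q_def)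
  have "gamma_ratio (q + 1) q s = q\<^sup>2 + s\<^sup>2" for s
  proof -
    have "Gamma (Complex (q + 1) s) = Complex q s * Gamma (Complex q s)"
      using Gamma_plus1[OF Complex_not_nonpos_Int[OF q, of s]]
      by (simp add: plus_complex.ctr)
    then show ?thesis
      using Gamma_Complex_nonzero[OF q, of s]
      by (simp add: gamma_ratio_def norm_mult power_mult_distrib)
         (simp add: cmod_power2)
  qed
  then have "gamma_ratio (q + 1) q (sqrt (real n - 2) / 2) = (q + 1) / q * gamma_ratio (q + 1) q 0"
    using q by (simp add: n power_divide real_sqrt_mult) (simp add: field_simps power2_eq_square)
  moreover have "real n / 4 + 1 / 2 = q + 1" "real n / 4 - 1 / 2 = q"
    by (simp_all add: q_def)
  ultimately show "gamma_equation n 1 (real n - 2)"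
    unfolding gamma_equation_iff by metis
qed (use assms in auto)

lemma tendsto_period_1:
  assumes "3 \<le> n"
  shows "(period n \<longlongrightarrow> period n 1) (at 1)"
    and "period n 1 = 2 * pi / sqrt (real n - 2)"
proof -
  have "isCont (\<lambda>\<gamma>. 2 * pi / sqrt (lambda_sol n \<gamma>)) 1"
    using isCont_lambda_sol[of 1 n] assms by (intro continuous_intros) (auto simp: lambda_sol_1)
  then show "(period n \<longlongrightarrow> period n 1) (at 1)"
    by (simp add: isCont_def period_def[abs_def])
  show "period n 1 = 2 * pi / sqrt (real n - 2)"
    by (simp add: period_def lambda_sol_1[OF assms])
qed

section \<open>Polar coordinates in logarithmic form\<close>

lemma borel_measurable_cis [measurable]: "cis \<in> borel_measurable borel"
  by (intro borel_measurable_continuous_onI continuous_intros)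

text \<open>
  With \<open>|x| = exp (- t)\<close> Lebesgue measure becomes a constant times \<open>exp (- n t) dt\<close>. It suffices to compare
  half-lines, and the preimage of \<open>t > a\<close> is a ball of radius \<open>exp (- a)\<close>.
\<close>

lemma distr_minus_ln_norm:
  "distr lborel borel (\<lambda>x::'a::euclidean_space. - ln (norm x))
     = density lborel (\<lambda>t. ennreal (real DIM('a) * unit_ball_vol DIM('a) * exp (- real DIM('a) * t)))"
    (is "?M = density lborel ?d")
proof (rule measure_eqI_lessThan)
  define N where "N = real DIM('a)"
  have N: "0 < N" by (simp add: N_def)
  define V where "V = unit_ball_vol N"
  have V: "0 < V" using N by (simp add: V_def)
  have M: "emeasure ?M {a<..} = ennreal (V * exp (- N * a))" for a
  proof -
    \<comment> \<open>The origin is removed because of the convention \<open>ln 0 = 0\<close>.\<close>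
    have eq: "(\<lambda>x::'a. - ln (norm x)) -` {a<..} - {0} = ball 0 (exp (- a)) - {0}"
    proof -
      have "a < - ln (norm x) \<longleftrightarrow> norm x < exp (- a)" if "x \<noteq> 0" for x :: 'a
        using that ln_less_cancel_iff[of "norm x" "exp (- a)"] by auto
      then show ?thesis by auto
    qed
    have m: "(\<lambda>x::'a. - ln (norm x)) -` {a<..} \<in> sets borel"
      using measurable_sets[of "\<lambda>x::'a. - ln (norm x)" borel borel "{a<..}"] by simp
    have "emeasure ?M {a<..} = emeasure lborel ((\<lambda>x::'a. - ln (norm x)) -` {a<..})"
      by (simp add: emeasure_distr)
    also have "\<dots> = emeasure lborel ((\<lambda>x::'a. - ln (norm x)) -` {a<..} - {0})"
      using m by (intro emeasure_Diff_null_set[symmetric]) (auto intro!: null_setsI)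
    also have "\<dots> = emeasure lborel (ball (0::'a) (exp (- a)))"
      unfolding eq by (intro emeasure_Diff_null_set) (auto intro!: null_setsI)
    also have "\<dots> = ennreal (V * exp (- N * a))"
      by (simp add: emeasure_ball V_def N_def flip: exp_of_nat_mult)
    finally show ?thesis .
  qed
  show "emeasure ?M {a<..} < \<infinity>" for a
    unfolding M by simp
  show "emeasure ?M {a<..} = emeasure (density lborel ?d) {a<..}" for a
  proof -
    have "emeasure (density lborel ?d) {a<..} = (\<integral>\<^sup>+x. ennreal (N * V * exp (- N * x)) * indicator {a<..} x \<partial>lborel)"
      unfolding N_def V_def by (rule emeasure_density) simp_all
    also have "\<dots> = (\<integral>\<^sup>+x. ennreal (N * V * exp (- N * x)) * indicator {a..} x \<partial>lborel)"
    proof (rule nn_integral_cong_AE)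
      show "AE x in lborel. ennreal (N * V * exp (- N * x)) * indicator {a<..} x
          = ennreal (N * V * exp (- N * x)) * indicator {a..} x"
        using AE_lborel_singleton[of a] by eventually_elim (simp add: indicator_def)
    qed
    also have "\<dots> = 0 - (- V * exp (- N * a))"
    proof (rule nn_integral_FTC_atLeast)
      show "((\<lambda>x. - V * exp (- N * x)) \<longlongrightarrow> 0) at_top"
        using N by real_asymp
    qed (use N V in \<open>auto intro!: derivative_eq_intros\<close>)
    finally show ?thesis unfolding M by simp
  qed
qed simp_all

context
  fixes F :: "real \<Rightarrow> complex"
  assumes F[measurable]: "F \<in> borel_measurable borel"
begin

lemma integrable_radial_iff:
  "integrable lborel (\<lambda>x::'a::euclidean_space. F (- ln (norm x)))
     \<longleftrightarrow> integrable lborel (\<lambda>t. of_real (exp (- real DIM('a) * t)) * F t)" (is "?L \<longleftrightarrow> ?R")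
proof -
  define K where "K = real DIM('a) * unit_ball_vol DIM('a)"
  have "0 < K" by (simp add: K_def)
  then have K: "K \<noteq> 0" by simp
  have "?L \<longleftrightarrow> integrable (distr lborel borel (\<lambda>x::'a. - ln (norm x))) F"
    by (rule integrable_distr_eq[symmetric]) simp_all
  also have "\<dots> \<longleftrightarrow> integrable lborel (\<lambda>t. (K * exp (- real DIM('a) * t)) *\<^sub>R F t)"
    unfolding distr_minus_ln_norm K_def by (rule integrable_density) simp_all
  also have "\<dots> \<longleftrightarrow> integrable lborel (\<lambda>t. K *\<^sub>R (of_real (exp (- real DIM('a) * t)) * F t))"
    by (simp add: scaleR_conv_of_real mult.assoc)
  also have "\<dots> \<longleftrightarrow> ?R"
  proof
    assume "integrable lborel (\<lambda>t. K *\<^sub>R (of_real (exp (- real DIM('a) * t)) * F t))"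
    then have "integrable lborel (\<lambda>t. inverse K *\<^sub>R (K *\<^sub>R (of_real (exp (- real DIM('a) * t)) * F t)))"
      by (rule integrable_scaleR_right)
    then show ?R using K by simp
  qed (rule integrable_scaleR_right)
  finally show ?thesis .
qed

lemma integral_radial:
  "(LINT x::'a::euclidean_space|lborel. F (- ln (norm x)))
     = of_real (real DIM('a) * unit_ball_vol DIM('a))
         * (LINT t|lborel. of_real (exp (- real DIM('a) * t)) * F t)"
proof -
  define K where "K = real DIM('a) * unit_ball_vol DIM('a)"
  have "(LINT x::'a|lborel. F (- ln (norm x))) = integral\<^sup>L (distr lborel borel (\<lambda>x::'a. - ln (norm x))) F"
    by (rule integral_distr[symmetric]) simp_all
  also have "\<dots> = (LINT t|lborel. (K * exp (- real DIM('a) * t)) *\<^sub>R F t)"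
    unfolding distr_minus_ln_norm K_def by (rule integral_density) simp_all
  also have "\<dots> = (LINT t|lborel. K *\<^sub>R (of_real (exp (- real DIM('a) * t)) * F t))"
    by (simp add: scaleR_conv_of_real mult.assoc)
  also have "\<dots> = K *\<^sub>R (LINT t|lborel. of_real (exp (- real DIM('a) * t)) * F t)"
    by (rule integral_scaleR_right)
  finally show ?thesis unfolding K_def scaleR_conv_of_real .
qed

end

section \<open>Gamma and Gaussian integrals\<close>

text \<open>
  Euler's integral for \<open>\<Gamma>\<close> after the substitution \<open>x = exp (- t)\<close>. In this form a dilation of the exponent
  is a translation of \<open>t\<close>, and all complex powers are exponentials.
\<close>

lemma Gamma_integral_exp:
  assumes s: "0 < Re s"
  shows "integrable lborel (\<lambda>t::real. exp (- s * of_real t) * of_real (exp (- exp (- t))))" (is ?int)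
    and "(LINT t|lborel. exp (- s * of_real t) * of_real (exp (- exp (- t)))) = Gamma s" (is ?eq)
proof -
  let ?f = "\<lambda>x::real. exp ((s - 1) * of_real (ln x)) * complex_of_real (exp (- x))"
  let ?F = "\<lambda>t::real. exp (- (s - 1) * of_real t) * of_real (exp (- exp (- t)))"
  let ?G = "\<lambda>t::real. exp (- s * of_real t) * complex_of_real (exp (- exp (- t)))"
  have fG: "of_real (exp (- real DIM(real) * t)) * ?F t = ?G t" for t
  proof -
    have "?G t = exp (of_real (- t)) * exp (- (s - 1) * of_real t) * of_real (exp (- exp (- t)))"
      unfolding exp_add[symmetric] by (simp add: left_diff_distrib)
    then show ?thesis by (simp add: exp_of_real mult.assoc del: of_real_minus)
  qed
  have f: "complex_of_real x powr (s - 1) / of_real (exp x) = ?f x" if "x \<in> {0<..}" for x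
    using that by (simp add: powr_def Ln_of_real exp_minus field_simps)
  have "set_integrable lebesgue {0<..} ?f \<longleftrightarrow>
      set_integrable lebesgue {0<..} (\<lambda>x. complex_of_real x powr (s - 1) / of_real (exp x))"
    by (rule set_integrable_cong) (use f in auto)
  then have abs: "set_integrable lebesgue {0<..} ?f"
    using absolutely_integrable_Gamma_integral'[OF s] by blast
  have hi: "(?f has_integral Gamma s) {0<..}"
    using Gamma_integral_complex'[OF s] by (rule has_integral_eq[rotated]) (use f in auto)
  have m: "?f \<in> borel_measurable borel" by measurable
  have abs': "set_integrable lborel {0<..} ?f"
    using abs m unfolding set_integrable_def
    by (subst (asm) integrable_completion) auto
  have gam: "(LINT x|lborel. indicator {0<..} x *\<^sub>R ?f x) = Gamma s"
    using set_borel_integral_eq_integral(2)[OF abs'] integral_unique[OF hi]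
    by (simp add: set_lebesgue_integral_def)
  \<comment> \<open>Polar coordinates in dimension \<open>1\<close> see both half-lines, hence the reflected copy of \<open>h\<close> and a factor \<open>2\<close>.\<close>
  define h where "h x = indicator {0<..} x *\<^sub>R ?f x" for x :: real
  have h_int: "integrable lborel h"
    using abs' by (simp add: h_def[abs_def] set_integrable_def)
  have h_int': "integrable lborel (\<lambda>x. h (- x))"
    using lborel_integrable_real_affine[OF h_int, of "-1" 0] by simp
  have AE: "AE x in lborel. ?F (- ln (norm x)) = h x + h (- x)"
    using AE_lborel_singleton[of 0]
  proof eventually_elim
    case (elim x)
    have "?F (- ln x) = ?f x" if "0 < x" for x
      using that by (simp add: algebra_simps)
    from this[of x] this[of "- x"] show ?case
      using elim by (cases "0 < x") (auto simp: h_def)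
  qed
  have Fm: "?F \<in> borel_measurable borel" by measurable
  have hm: "h \<in> borel_measurable borel" using h_int by auto
  have "integrable lborel (\<lambda>x::real. ?F (- ln (norm x)))"
    using Bochner_Integration.integrable_add[OF h_int h_int']
    by (rule integrable_cong_AE_imp) (use AE Fm hm in auto)
  then show int: ?int
    unfolding integrable_radial_iff[OF Fm, where 'a = real] fG .
  have "(LINT x::real|lborel. ?F (- ln (norm x))) = (LINT x|lborel. h x + h (- x))"
    by (rule integral_cong_AE) (use AE Fm hm in auto)
  also have "\<dots> = (LINT x|lborel. h x) + (LINT x|lborel. h (- x))"
    by (rule Bochner_Integration.integral_add[OF h_int h_int'])
  also have "(LINT x|lborel. h (- x)) = (LINT x|lborel. h x)"
    using lborel_integral_real_affine[of "-1" h 0] by simp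
  also have "(LINT x|lborel. h x) = Gamma s"
    using gam by (simp add: h_def)
  finally have "2 * (LINT t|lborel. ?G t) = 2 * Gamma s"
    unfolding integral_radial[OF Fm, where 'a = real] fG by simp
  then show ?eq by simp
qed

lemma Gamma_integral_exp_scaled:
  assumes s: "0 < Re s" and a: "0 < a"
  shows "integrable lborel (\<lambda>t::real. exp (- s * of_real t) * of_real (exp (- (a * exp (- t)))))" (is ?int)
    and "(LINT t|lborel. exp (- s * of_real t) * of_real (exp (- (a * exp (- t)))))
           = exp (- s * of_real (ln a)) * Gamma s" (is ?eq)
proof -
  let ?G = "\<lambda>t::real. exp (- s * of_real t) * complex_of_real (exp (- exp (- t)))"
  let ?H = "\<lambda>t::real. exp (- s * of_real t) * complex_of_real (exp (- (a * exp (- t))))"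
  have H: "?H t = exp (- s * of_real (ln a)) * ?G (- ln a + 1 * t)" for t
  proof -
    have "exp (- (- ln a + 1 * t)) = exp (ln a) * exp (- t)"
      unfolding exp_add[symmetric] by simp
    then have "exp (- (- ln a + 1 * t)) = a * exp (- t)"
      using a by simp
    moreover have "- s * of_real t = - s * of_real (ln a) + - s * of_real (- ln a + 1 * t)"
      by (simp add: algebra_simps)
    then have "exp (- s * of_real t) = exp (- s * of_real (ln a)) * exp (- s * of_real (- ln a + 1 * t))"
      by (simp only: exp_add)
    ultimately show ?thesis by simp
  qed
  have int: "integrable lborel (\<lambda>t. ?G (- ln a + 1 * t))"
    by (rule lborel_integrable_real_affine[OF Gamma_integral_exp(1)[OF s]]) simp
  then show ?int unfolding H by (rule integrable_mult_right)
  have "(LINT t|lborel. ?G (- ln a + 1 * t)) = Gamma s"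
    using lborel_integral_real_affine[of 1 ?G "- ln a"] Gamma_integral_exp(2)[OF s] by simp
  then show ?eq unfolding H by simp
qed

lemma Gamma_integral_exp_norm:
  assumes s: "0 < Re s" and a: "0 < a"
  shows "(LINT t|lborel. norm (exp (- s * of_real t) * complex_of_real (exp (- (a * exp (- t))))))
           = exp (- Re s * ln a) * Gamma (Re s)"
proof -
  have "complex_of_real (LINT t|lborel. norm (exp (- s * of_real t) * complex_of_real (exp (- (a * exp (- t))))))
      = (LINT t|lborel. exp (- of_real (Re s) * of_real t) * complex_of_real (exp (- (a * exp (- t)))))"
    unfolding integral_complex_of_real[symmetric] by (simp add: norm_mult flip: exp_of_real)
  also have "\<dots> = of_real (exp (- Re s * ln a) * Gamma (Re s))"
    using Gamma_integral_exp_scaled(2)[of "of_real (Re s)" a] s a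
    by (simp add: Gamma_complex_of_real flip: exp_of_real)
  finally show ?thesis by (simp only: of_real_eq_iff)
qed

text \<open>
  The characteristic function of the standard normal distribution, rescaled.
\<close>

lemma fourier_gaussian_1d:
  fixes b y :: real
  assumes b: "0 < b"
  shows "integrable lborel (\<lambda>x. complex_of_real (exp (- (b * x\<^sup>2))) * cis (- (x * y)))"
    and "(LINT x|lborel. complex_of_real (exp (- (b * x\<^sup>2))) * cis (- (x * y)))
           = of_real (sqrt (pi / b) * exp (- (y\<^sup>2 / (4 * b))))"
proof -
  let ?g = "\<lambda>t x. cis (t * x) * complex_of_real (std_normal_density x)"
  have norm_int: "integrable lborel std_normal_density"
    using integrable_std_normal_moment[of 0] by simp
  have int1: "integrable lborel (?g t)" for t
  proof (rule Bochner_Integration.integrable_bound[OF norm_int])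
    show "?g t \<in> borel_measurable lborel" by measurable
    show "AE x in lborel. norm (?g t x) \<le> norm (std_normal_density x)"
      by (simp only: norm_mult norm_cis norm_of_real) simp
  qed
  have eq1: "(LINT x|lborel. ?g t x) = of_real (exp (- (t\<^sup>2) / 2))" for t
  proof -
    have "char std_normal_distribution t = (LINT x|lborel. std_normal_density x *\<^sub>R iexp (t * x))"
      unfolding char_def by (rule integral_density) (auto simp: normal_density_nonneg)
    also have "\<dots> = (LINT x|lborel. ?g t x)"
      by (simp only: scaleR_conv_of_real cis_conv_exp mult.commute[of "of_real (std_normal_density _)"])
    finally show ?thesis
      unfolding char_std_normal_distribution by simp
  qed
  define c where "c = sqrt (2 * b)"
  have c: "0 < c" "c\<^sup>2 = 2 * b" using b by (auto simp: c_def)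
  have eq: "complex_of_real (exp (- (b * x\<^sup>2))) * cis (- (x * y))
      = of_real (sqrt (2 * pi)) * ?g (- y / c) (0 + c * x)" for x
    using c by (simp add: std_normal_density_def power_mult_distrib field_simps real_sqrt_mult)
  show "integrable lborel (\<lambda>x. complex_of_real (exp (- (b * x\<^sup>2))) * cis (- (x * y)))"
    unfolding eq using c by (intro integrable_mult_right lborel_integrable_real_affine int1) auto
  have "(LINT x|lborel. ?g (- y / c) (0 + c * x)) = of_real (exp (- ((y / c)\<^sup>2) / 2)) / of_real c"
    using lborel_integral_real_affine[of c "?g (- y / c)" 0] eq1[of "- y / c"] c
    by (simp add: scaleR_conv_of_real field_simps)
  moreover have "sqrt (2 * pi) * (exp (- ((y / c)\<^sup>2) / 2) / c) = sqrt (pi / b) * exp (- (y\<^sup>2 / (4 * b)))"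
    using c b by (simp add: power_divide real_sqrt_mult real_sqrt_divide c_def field_simps)
  ultimately show "(LINT x|lborel. complex_of_real (exp (- (b * x\<^sup>2))) * cis (- (x * y)))
           = of_real (sqrt (pi / b) * exp (- (y\<^sup>2 / (4 * b))))"
    unfolding eq Bochner_Integration.integral_mult_right_zero
    by (simp only: of_real_mult[symmetric] of_real_divide[symmetric])
qed

lemma fourier_gaussian:
  fixes y :: "'a::euclidean_space"
  assumes b: "0 < b"
  shows "integrable lborel (\<lambda>x. complex_of_real (exp (- (b * (norm x)\<^sup>2))) * cis (- (x \<bullet> y)))"
    and "(LINT x|lborel. complex_of_real (exp (- (b * (norm x)\<^sup>2))) * cis (- (x \<bullet> y)))
           = of_real (sqrt (pi / b) ^ DIM('a) * exp (- ((norm y)\<^sup>2 / (4 * b))))"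
proof -
  interpret product_sigma_finite "\<lambda>_. lborel :: real measure" ..
  let ?h = "\<lambda>u x. complex_of_real (exp (- (b * x\<^sup>2))) * cis (- (x * u))"
  let ?f = "\<lambda>x::'a. \<Prod>e\<in>Basis. ?h (y \<bullet> e) (x \<bullet> e)"
  have cis_sum: "cis (sum f A) = (\<Prod>e\<in>A. cis (f e))" if "finite A" for f and A :: "'a set"
    using that by induction (auto simp: cis_mult[symmetric])
  have nsq: "(norm x)\<^sup>2 = (\<Sum>e\<in>Basis. (x \<bullet> e)\<^sup>2)" for x :: 'a
    unfolding power2_norm_eq_inner by (subst euclidean_inner) (simp add: power2_eq_square)
  have f: "complex_of_real (exp (- (b * (norm x)\<^sup>2))) * cis (- (x \<bullet> y)) = ?f x" for x
    unfolding prod.distrib nsq euclidean_inner[of x y]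
    by (simp add: cis_sum exp_sum sum_distrib_left flip: sum_negf)
  let ?P = "Pi\<^sub>M Basis (\<lambda>_::'a. lborel :: real measure)"
  let ?T = "\<lambda>g. \<Sum>e\<in>Basis. g e *\<^sub>R (e::'a)"
  have T: "?T g \<bullet> e = g e" if "e \<in> Basis" for g e
    using that by simp
  have fT: "?f (?T g) = (\<Prod>e\<in>Basis. ?h (y \<bullet> e) (g e))" for g
    by (intro prod.cong) (simp_all add: T)
  have fm: "?f \<in> borel_measurable borel" by measurable
  have Tm: "?T \<in> measurable ?P borel" by measurable
  have lb: "lborel = distr ?P borel ?T" by (rule lborel_eq)
  have "integrable ?P (\<lambda>g. \<Prod>e\<in>Basis. ?h (y \<bullet> e) (g e))"
    by (rule product_integrable_prod) (auto intro: fourier_gaussian_1d b)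
  then have "integrable (distr ?P borel ?T) ?f"
    unfolding integrable_distr_eq[OF Tm fm] fT .
  then show "integrable lborel (\<lambda>x. complex_of_real (exp (- (b * (norm x)\<^sup>2))) * cis (- (x \<bullet> y)))"
    unfolding f lb .
  have "(LINT x|lborel. ?f x) = (LINT g|?P. ?f (?T g))"
    unfolding lb by (rule integral_distr[OF Tm fm])
  also have "\<dots> = (\<Prod>e\<in>Basis. LINT x|lborel. ?h (y \<bullet> e) x)"
    unfolding fT by (rule product_integral_prod) (auto intro: fourier_gaussian_1d b)
  also have "\<dots> = of_real (sqrt (pi / b) ^ DIM('a) * exp (- ((norm y)\<^sup>2 / (4 * b))))"
    unfolding fourier_gaussian_1d[OF b] nsq
    by (simp add: prod.distrib exp_sum sum_divide_distrib flip: sum_negf of_real_prod)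
  finally show "(LINT x|lborel. complex_of_real (exp (- (b * (norm x)\<^sup>2))) * cis (- (x \<bullet> y)))
           = of_real (sqrt (pi / b) ^ DIM('a) * exp (- ((norm y)\<^sup>2 / (4 * b))))"
    unfolding f .
qed

section \<open>The Fourier transform of powers of the norm\<close>

text \<open>
  The power of the norm with a complex exponent, except that the convention \<open>ln 0 = 0\<close> gives the value \<open>1\<close> at
  the origin; the origin is a null set, so this does not affect any integral.
\<close>

definition npow :: "complex \<Rightarrow> 'a::real_normed_vector \<Rightarrow> complex" where
  "npow z x = exp (z * of_real (ln (norm x)))"

lemma borel_measurable_npow [measurable]:
  "npow z \<in> borel_measurable (borel :: 'a::{real_normed_vector,second_countable_topology} measure)"
  unfolding npow_def by measurable

lemma norm_npow: "norm (npow z x) = exp (Re z * ln (norm x))"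
  by (simp add: npow_def)

lemma npow_add: "npow (z + w) x = npow z x * npow w x"
  by (simp add: npow_def distrib_right exp_add)

lemma lborel_integral_swap:
  fixes f :: "'a::euclidean_space \<Rightarrow> 'b::euclidean_space \<Rightarrow> complex"
  assumes meas: "case_prod f \<in> borel_measurable (lborel \<Otimes>\<^sub>M lborel)"
    and fst: "AE x in lborel. integrable lborel (f x)"
    and int: "integrable lborel (\<lambda>x. LINT y|lborel. norm (f x y))"
  shows "(LINT x|lborel. LINT y|lborel. f x y) = (LINT y|lborel. LINT x|lborel. f x y)"
proof -
  have "integrable (lborel \<Otimes>\<^sub>M lborel) (case_prod f)"
    using assms by (intro lborel_pair.Fubini_integrable) auto
  then show ?thesis
    by (rule lborel_pair.Fubini_integral[symmetric])
qed

lemma borel_measurable_fourier [measurable]: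
  assumes [measurable]: "f \<in> borel_measurable borel"
  shows "fourier f \<in> borel_measurable borel"
proof -
  have "(\<lambda>\<xi>. LINT x|lborel. f x * cis (- (x \<bullet> \<xi>))) \<in> borel_measurable borel"
    by (rule lborel.borel_measurable_lebesgue_integral) measurable
  then show ?thesis by (simp add: fourier_def[abs_def])
qed

lemma norm_fourier_le: "norm (fourier f \<xi>) \<le> (LINT x|lborel. norm (f x))"
  unfolding fourier_def by (rule order_trans[OF integral_norm_bound]) (simp add: norm_mult)

text \<open>
  Fubini moves the Fourier transform from \<open>f\<close> to the Gaussian.
\<close>

lemma integral_gaussian_fourier:
  fixes f :: "real ^ 'n \<Rightarrow> complex"
  assumes f: "integrable lborel f" and b: "0 < b"
  shows "(LINT x|lborel. complex_of_real (exp (- (b * (norm x)\<^sup>2))) * fourier f x)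
     = of_real (sqrt (pi / b) ^ CARD('n)) * (LINT y|lborel. of_real (exp (- ((norm y)\<^sup>2 / (4 * b)))) * f y)"
proof -
  let ?g = "\<lambda>x::real^'n. complex_of_real (exp (- (b * (norm x)\<^sup>2)))"
  have [measurable]: "f \<in> borel_measurable borel" using f by auto
  have g_int: "integrable lborel (\<lambda>x::real^'n. norm (?g x))"
    using integrable_norm[OF fourier_gaussian(1)[OF b, of "0::real^'n"]] by simp
  have "(LINT x|lborel. ?g x * fourier f x)
      = (LINT x|lborel. LINT y|lborel. ?g x * (f y * cis (- (y \<bullet> x))))"
    by (simp add: fourier_def)
  also have "\<dots> = (LINT y|lborel. LINT x|lborel. ?g x * (f y * cis (- (y \<bullet> x))))"
  proof (rule lborel_integral_swap)
    show "AE x in lborel. integrable lborel (\<lambda>y. ?g x * (f y * cis (- (y \<bullet> x))))"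
    proof (rule AE_I2, rule integrable_mult_right)
      show "integrable lborel (\<lambda>y. f y * cis (- (y \<bullet> x)))" for x
        by (rule Bochner_Integration.integrable_bound[OF f]) (auto simp: norm_mult)
    qed
    show "integrable lborel (\<lambda>x. LINT y|lborel. norm (?g x * (f y * cis (- (y \<bullet> x)))))"
      using g_int by (simp add: norm_mult)
  qed measurable
  also have "\<dots> = (LINT y|lborel. f y * (LINT x|lborel. ?g x * cis (- (x \<bullet> y))))"
    by (simp add: inner_commute mult.left_commute)
  also have "\<dots> = (LINT y|lborel. of_real (sqrt (pi / b) ^ CARD('n)) * (of_real (exp (- ((norm y)\<^sup>2 / (4 * b)))) * f y))"
    unfolding fourier_gaussian(2)[OF b] by (simp add: mult_ac)
  finally show ?thesis by simp
qed

text \<open>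
  As a distribution, the Fourier transform of \<open>|x| powr (-z)\<close> is a multiple of \<open>|y| powr (z - n)\<close>. Indeed
  \<open>\<Gamma>(z/2) |x| powr (-z)\<close> is the integral over \<open>t\<close> of \<open>exp (- z t / 2) exp (- |x|\<^sup>2 exp (- t))\<close>, a superposition
  of Gaussians. The Fourier transform maps the Gaussian of parameter \<open>t\<close> to one of parameter \<open>- t\<close>, and the
  superposition of the transformed Gaussians is again a power of the norm. The two integrability
  hypotheses are exactly what Fubini needs before and after the transformation.
\<close>

theorem integral_npow_fourier:
  fixes f :: "real ^ 'n \<Rightarrow> complex"
  assumes f: "integrable lborel f" and z: "0 < Re z" "Re z < CARD('n)"
    and A: "integrable lborel (\<lambda>x. npow (- z) x * fourier f x)"
    and B: "integrable lborel (\<lambda>y. npow (z - of_nat CARD('n)) y * f y)"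
  shows "Gamma (z / 2) * (LINT x|lborel. npow (- z) x * fourier f x)
    = of_real (sqrt pi ^ CARD('n)) * exp ((of_nat CARD('n) - z) * of_real (ln 2))
        * Gamma ((of_nat CARD('n) - z) / 2) * (LINT y|lborel. npow (z - of_nat CARD('n)) y * f y)"
proof -
  define N where "N = CARD('n)"
  define J where "J s a t = exp (- s * of_real t) * complex_of_real (exp (- (a * exp (- t))))"
    for s :: complex and a t :: real
  have J_int: "integrable lborel (J s a)" and J_eq: "integral\<^sup>L lborel (J s a) = exp (- s * of_real (ln a)) * Gamma s"
    and J_norm: "(LINT t|lborel. norm (J s a t)) = exp (- Re s * ln a) * Gamma (Re s)"
    if "0 < Re s" "0 < a" for s a
    unfolding J_def[abs_def] using Gamma_integral_exp_scaled[OF that] Gamma_integral_exp_norm[OF that] by auto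
  have [measurable]: "f \<in> borel_measurable borel" using f by auto
  have [measurable]: "(\<lambda>(x::real^'n, t). J s ((norm x)\<^sup>2 / c) t) \<in> borel_measurable (borel \<Otimes>\<^sub>M borel)" for s c
    unfolding J_def by measurable
  \<comment> \<open>The superposition, used with \<open>s = z/2\<close>, \<open>c = 1\<close> before and with \<open>s = (n - z)/2\<close>, \<open>c = 4\<close> after the transformation.\<close>
  have super: "(LINT x|lborel. npow (- (2 * s)) x * h x) * (exp (s * of_real (ln c)) * Gamma s)
      = (LINT t|lborel. LINT x|lborel. J s ((norm x)\<^sup>2 / c) t * h x)"
    if s: "0 < Re s" and c: "0 < c" and h[measurable]: "h \<in> borel_measurable borel"
      and int: "integrable lborel (\<lambda>x. npow (- (2 * s)) x * h x)"
    for s c and h :: "real^'n \<Rightarrow> complex"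
  proof -
    have nz: "AE x in lborel. x \<noteq> (0::real^'n)" by (rule AE_lborel_singleton)
    have ln: "ln ((norm x)\<^sup>2 / c) = 2 * ln (norm x) - ln c" if "x \<noteq> 0" for x :: "real^'n"
      using that c by (simp add: ln_div ln_realpow)
    have pos: "0 < (norm x)\<^sup>2 / c" if "x \<noteq> 0" for x :: "real^'n"
      using that c by simp
    have 1: "(LINT t|lborel. J s ((norm x)\<^sup>2 / c) t * h x)
        = npow (- (2 * s)) x * h x * (exp (s * of_real (ln c)) * Gamma s)" if "x \<noteq> 0" for x
    proof -
      have "- s * of_real (ln ((norm x)\<^sup>2 / c)) = - (2 * s) * of_real (ln (norm x)) + s * of_real (ln c)"
        unfolding ln[OF that] by (simp add: algebra_simps)
      then have "exp (- s * of_real (ln ((norm x)\<^sup>2 / c))) = npow (- (2 * s)) x * exp (s * of_real (ln c))"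
        by (simp only: npow_def exp_add)
      then show ?thesis
        using J_eq[OF s pos[OF that]] by (simp add: mult_ac)
    qed
    have 2: "(LINT t|lborel. norm (J s ((norm x)\<^sup>2 / c) t * h x))
        = norm (npow (- (2 * s)) x * h x) * (exp (Re s * ln c) * Gamma (Re s))" if "x \<noteq> 0" for x
    proof -
      have "- Re s * (ln ((norm x)\<^sup>2 / c)) = - (2 * Re s) * (ln (norm x)) + Re s * (ln c)"
        unfolding ln[OF that] by (simp add: algebra_simps)
      then have "exp (- Re s * (ln ((norm x)\<^sup>2 / c))) = norm (npow (- (2 * s)) x) * exp (Re s * (ln c))"
        by (simp only: norm_npow exp_add) simp
      then show ?thesis
        using J_norm[OF s pos[OF that]] by (simp add: norm_mult mult_ac)
    qed
    have "(LINT x|lborel. npow (- (2 * s)) x * h x) * (exp (s * of_real (ln c)) * Gamma s)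
        = (LINT x|lborel. npow (- (2 * s)) x * h x * (exp (s * of_real (ln c)) * Gamma s))"
      by (rule Bochner_Integration.integral_mult_left_zero[symmetric])
    also have "\<dots> = (LINT x|lborel. LINT t|lborel. J s ((norm x)\<^sup>2 / c) t * h x)"
    proof (rule integral_cong_AE)
      show "AE x in lborel. npow (- (2 * s)) x * h x * (exp (s * of_real (ln c)) * Gamma s)
          = (LINT t|lborel. J s ((norm x)\<^sup>2 / c) t * h x)"
        using nz by eventually_elim (rule 1[symmetric])
    qed measurable
    also have "\<dots> = (LINT t|lborel. LINT x|lborel. J s ((norm x)\<^sup>2 / c) t * h x)"
    proof (rule lborel_integral_swap)
      show "AE x in lborel. integrable lborel (\<lambda>t. J s ((norm x)\<^sup>2 / c) t * h x)"
        using nz by eventually_elim (intro integrable_mult_left J_int s pos)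
      have "integrable lborel (\<lambda>x. norm (npow (- (2 * s)) x * h x) * (exp (Re s * ln c) * Gamma (Re s)))"
        using int by (intro integrable_mult_left integrable_norm)
      then show "integrable lborel (\<lambda>x. LINT t|lborel. norm (J s ((norm x)\<^sup>2 / c) t * h x))"
      proof (rule integrable_cong_AE_imp)
        show "AE x in lborel. norm (npow (- (2 * s)) x * h x) * (exp (Re s * ln c) * Gamma (Re s))
            = (LINT t|lborel. norm (J s ((norm x)\<^sup>2 / c) t * h x))"
          using nz by eventually_elim (rule 2[symmetric])
      qed measurable
    qed measurable
    finally show ?thesis .
  qed
  let ?w = "(of_nat N - z) / 2"
  have "(LINT x|lborel. npow (- z) x * fourier f x) * Gamma (z / 2)
      = (LINT t|lborel. LINT x|lborel. J (z / 2) ((norm x)\<^sup>2) t * fourier f x)"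
    using super[of "z / 2" 1 "fourier f"] z A by simp
  also have "\<dots> = (LINT t|lborel. of_real (sqrt pi ^ N) * (LINT y|lborel. J ?w ((norm y)\<^sup>2 / 4) (- t) * f y))"
  proof (rule Bochner_Integration.integral_cong[OF refl])
    fix t :: real
    have e: "exp (- (z / 2) * of_real t) * of_real (exp (t / 2) ^ N) = exp (- ?w * of_real (- t))"
    proof -
      have "complex_of_real (exp (t / 2) ^ N) = exp (of_nat N * of_real (t / 2))"
        using exp_of_nat_mult[of N "complex_of_real (t / 2)"] by (simp flip: exp_of_real)
      then show ?thesis
        by (simp add: exp_add[symmetric]) (simp add: field_simps)
    qed
    have sq: "sqrt (pi / exp (- t)) = sqrt pi * exp (t / 2)"
    proof (rule real_sqrt_unique)
      have "exp (t / 2) * exp (t / 2) * exp (- t) = 1" by (simp flip: exp_add)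
      then have "(sqrt pi * exp (t / 2))\<^sup>2 * exp (- t) = pi"
        by (simp only: power_mult_distrib real_sqrt_pow2[OF pi_ge_zero] power2_eq_square[of "exp _"] mult.assoc)
      then show "(sqrt pi * exp (t / 2))\<^sup>2 = pi / exp (- t)"
        by (rule eq_divide_imp[rotated]) simp
    qed simp
    have "(LINT x|lborel. J (z / 2) ((norm x)\<^sup>2) t * fourier f x)
        = exp (- (z / 2) * of_real t) * (LINT x|lborel. of_real (exp (- (exp (- t) * (norm x)\<^sup>2))) * fourier f x)"
    proof -
      have "J (z / 2) ((norm x)\<^sup>2) t * fourier f x = exp (- (z / 2) * of_real t)
          * (of_real (exp (- (exp (- t) * (norm x)\<^sup>2))) * fourier f x)" for x
        by (simp only: J_def mult.assoc mult.commute[of "exp (- t)"])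
      then show ?thesis by (simp only: Bochner_Integration.integral_mult_right_zero)
    qed
    also have "\<dots> = exp (- (z / 2) * of_real t) * (of_real (sqrt pi ^ N * exp (t / 2) ^ N)
        * (LINT y|lborel. of_real (exp (- ((norm y)\<^sup>2 / (4 * exp (- t))))) * f y))"
      by (subst integral_gaussian_fourier[OF f]) (simp_all add: sq N_def power_mult_distrib)
    also have "\<dots> = of_real (sqrt pi ^ N) * (exp (- ?w * of_real (- t))
        * (LINT y|lborel. of_real (exp (- ((norm y)\<^sup>2 / (4 * exp (- t))))) * f y))"
      unfolding e[symmetric] by (simp only: of_real_mult mult_ac)
    also have "\<dots> = of_real (sqrt pi ^ N) * (LINT y|lborel. J ?w ((norm y)\<^sup>2 / 4) (- t) * f y)"
    proof -
      have "(norm y)\<^sup>2 / (4 * exp (- t)) = (norm y)\<^sup>2 / 4 * exp (- (- t))" for y :: "real^'n"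
      proof -
        have "exp (- t) * exp (- (- t)) = 1" by (simp flip: exp_add)
        then have "exp (- (- t)) = 1 / exp (- t)"
          by (simp only: eq_divide_eq mult.commute) simp
        then show ?thesis by (simp only: times_divide_eq_right times_divide_eq_left divide_divide_eq_left mult_1_right)
      qed
      then have "J ?w ((norm y)\<^sup>2 / 4) (- t) * f y = exp (- ?w * of_real (- t))
          * (of_real (exp (- ((norm y)\<^sup>2 / (4 * exp (- t))))) * f y)" for y
        by (simp only: J_def mult.assoc)
      then show ?thesis by (simp only: Bochner_Integration.integral_mult_right_zero)
    qed
    finally show "(LINT x|lborel. J (z / 2) ((norm x)\<^sup>2) t * fourier f x) = \<dots>" .
  qed
  also have "\<dots> = of_real (sqrt pi ^ N) * (LINT t|lborel. LINT y|lborel. J ?w ((norm y)\<^sup>2 / 4) (- t) * f y)"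
    by (rule Bochner_Integration.integral_mult_right_zero)
  also have "(LINT t|lborel. LINT y|lborel. J ?w ((norm y)\<^sup>2 / 4) (- t) * f y)
      = (LINT t|lborel. LINT y|lborel. J ?w ((norm y)\<^sup>2 / 4) t * f y)"
    using lborel_integral_real_affine[of "-1" "\<lambda>t. LINT y|lborel. J ?w ((norm y)\<^sup>2 / 4) t * f y" 0] by simp
  also have "\<dots> = (LINT x|lborel. npow (z - of_nat N) x * f x) * (exp (?w * of_real (ln 4)) * Gamma ?w)"
  proof -
    have w: "- (2 * ?w) = z - of_nat N" by (simp add: diff_divide_distrib)
    have "0 < Re ?w" using z by (simp add: N_def)
    then show ?thesis
      using super[of ?w 4 f, unfolded w] B by (simp add: N_def)
  qed
  also have "exp (?w * of_real (ln 4)) = exp ((of_nat N - z) * of_real (ln 2))"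
    using ln_realpow[of 2 2] by simp
  finally show ?thesis by (simp add: N_def mult_ac)
qed

section \<open>Integration by parts\<close>

lemma integrable_continuous_bounded_support:
  fixes g :: "'a::euclidean_space \<Rightarrow> complex"
  assumes "continuous_on UNIV g" and "\<And>y. R < norm y \<Longrightarrow> g y = 0"
  shows "integrable lborel g"
proof -
  have "integrable lborel (\<lambda>x. indicator (cball 0 R) x *\<^sub>R g x)"
    by (rule borel_integrable_compact) (auto intro: continuous_on_subset[OF assms(1)])
  also have "(\<lambda>x. indicator (cball 0 R) x *\<^sub>R g x) = g"
    using assms(2) by (auto simp: fun_eq_iff indicator_def)
  finally show ?thesis .
qed

lemma
  fixes g :: "'a::euclidean_space \<Rightarrow> complex"
  shows lborel_integral_translate: "(LINT y|lborel. g (c + y)) = (LINT y|lborel. g y)"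
    and lborel_integrable_translate: "integrable lborel g \<Longrightarrow> integrable lborel (\<lambda>y. g (c + y))"
proof -
  have int: "integrable lborel (\<lambda>y. g (c + y))" if g: "integrable lborel g" for g :: "'a \<Rightarrow> complex" and c
  proof -
    have [measurable]: "g \<in> borel_measurable borel" using g by auto
    have "integrable (distr lborel borel ((+) c)) g"
      using g by (simp add: lborel_distr_plus)
    then show ?thesis by (subst (asm) integrable_distr_eq) auto
  qed
  then show "integrable lborel g \<Longrightarrow> integrable lborel (\<lambda>y. g (c + y))" .
  show "(LINT y|lborel. g (c + y)) = (LINT y|lborel. g y)"
  proof (cases "integrable lborel g")
    case True
    then have [measurable]: "g \<in> borel_measurable borel" by auto
    have "(LINT y|distr lborel borel ((+) c). g y) = (LINT y|lborel. g (c + y))"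
      by (rule integral_distr) auto
    then show ?thesis by (simp add: lborel_distr_plus)
  next
    case False
    moreover have "\<not> integrable lborel (\<lambda>y. g (c + y))"
      using int[of "\<lambda>y. g (c + y)" "- c"] False by (auto simp: add.assoc[symmetric])
    ultimately show ?thesis by (simp add: not_integrable_integral_eq)
  qed
qed

text \<open>
  The integral of a difference quotient of \<open>F\<close> vanishes, as Lebesgue measure is invariant under
  translations; dominated convergence carries this over to the derivative.
\<close>

lemma integral_directional_derivative_eq_0:
  fixes F F' :: "'a::euclidean_space \<Rightarrow> complex"
  assumes deriv: "\<And>y. ((\<lambda>s. F (y + s *\<^sub>R e)) has_vector_derivative F' y) (at 0)"
    and contF: "continuous_on UNIV F" and contF': "continuous_on UNIV F'"
    and suppF: "\<And>y. R < norm y \<Longrightarrow> F y = 0" and suppF': "\<And>y. R < norm y \<Longrightarrow> F' y = 0"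
  shows "(LINT y|lborel. F' y) = 0"
proof -
  have "compact (F' ` cball 0 R)"
    by (intro compact_continuous_image continuous_on_subset[OF contF']) auto
  then obtain M0 where M0: "norm (F' y) \<le> M0" if "norm y \<le> R" for y
    by (force dest!: compact_imp_bounded simp: bounded_iff)
  define M where "M = max M0 0"
  have M: "norm (F' y) \<le> M" for y
    using M0[of y] suppF'[of y] by (cases "norm y \<le> R") (auto simp: M_def le_max_iff_disj)
  have deriv': "((\<lambda>s. F (y + s *\<^sub>R e)) has_derivative (\<lambda>h. h *\<^sub>R F' (y + s *\<^sub>R e))) (at s)" for y s
  proof -
    have "((\<lambda>h. F (y + s *\<^sub>R e + h *\<^sub>R e)) \<circ> (\<lambda>s'. s' - s) has_vector_derivative 1 *\<^sub>R F' (y + s *\<^sub>R e)) (at s)"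
      by (rule vector_diff_chain_at) (auto intro!: derivative_eq_intros deriv)
    moreover have "(\<lambda>h. F (y + s *\<^sub>R e + h *\<^sub>R e)) \<circ> (\<lambda>s'. s' - s) = (\<lambda>s. F (y + s *\<^sub>R e))"
      by (simp add: fun_eq_iff algebra_simps)
    ultimately show ?thesis by (simp add: has_vector_derivative_def)
  qed
  have lip: "norm (F (y + h *\<^sub>R e) - F y) \<le> M * \<bar>h\<bar>" for y h
  proof -
    have "norm (F (y + h *\<^sub>R e) - F (y + 0 *\<^sub>R e)) \<le> M * norm (h - 0)"
    proof (rule differentiable_bound[of UNIV])
      show "((\<lambda>s. F (y + s *\<^sub>R e)) has_derivative (\<lambda>h. h *\<^sub>R F' (y + s *\<^sub>R e))) (at s within UNIV)" for s
        using deriv' by simp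
      show "onorm (\<lambda>h. h *\<^sub>R F' (y + s *\<^sub>R e)) \<le> M" for s
        by (rule onorm_le) (use M in \<open>simp add: mult.commute[of M] mult_left_mono\<close>)
    qed auto
    then show ?thesis by simp
  qed
  define h where "h n = 1 / real (Suc n)" for n
  have h: "0 < h n" "h n \<le> 1" for n by (simp_all add: h_def)
  have h0: "h \<longlonglongrightarrow> 0" unfolding h_def by (rule LIMSEQ_Suc[OF lim_1_over_n])
  define Q where "Q n y = (F (y + h n *\<^sub>R e) - F y) /\<^sub>R h n" for n y
  have Fint: "integrable lborel F"
    by (rule integrable_continuous_bounded_support[OF contF suppF])
  have [measurable]: "F \<in> borel_measurable borel" "F' \<in> borel_measurable borel"
    using contF contF' by (auto intro: borel_measurable_continuous_onI)
  have "(LINT y|lborel. Q n y) = 0" for n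
    using lborel_integral_translate[of F "h n *\<^sub>R e"] lborel_integrable_translate[OF Fint, of "h n *\<^sub>R e"] Fint
    by (simp add: Q_def add.commute)
  moreover have "(\<lambda>n. LINT y|lborel. Q n y) \<longlonglongrightarrow> (LINT y|lborel. F' y)"
  proof (rule integral_dominated_convergence[where w = "\<lambda>y. indicator (cball 0 (R + norm e)) y * M"])
    show "integrable lborel (\<lambda>y::'a. indicator (cball 0 (R + norm e)) y * M)"
      by (intro integrable_mult_left integrable_real_indicator) (use emeasure_bounded_finite[OF bounded_cball] in auto)
    show "AE y in lborel. (\<lambda>n. Q n y) \<longlonglongrightarrow> F' y"
    proof (rule AE_I2)
      fix y
      have "((\<lambda>s. (F (y + s *\<^sub>R e) - F y) /\<^sub>R s) \<longlongrightarrow> F' y) (at 0)"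
      proof (rule Lim_transform_eventually)
        have "((\<lambda>s. norm (F (y + s *\<^sub>R e) - F y - s *\<^sub>R F' y) / \<bar>s\<bar>) \<longlongrightarrow> 0) (at 0)"
          using deriv[of y] by (simp add: has_vector_derivative_def has_derivative_at)
        then have "((\<lambda>s. norm ((F (y + s *\<^sub>R e) - F y - s *\<^sub>R F' y) /\<^sub>R s)) \<longlongrightarrow> 0) (at 0)"
          by (simp add: divide_inverse mult.commute)
        then have "((\<lambda>s. (F (y + s *\<^sub>R e) - F y - s *\<^sub>R F' y) /\<^sub>R s) \<longlongrightarrow> 0) (at 0)"
          by (rule tendsto_norm_zero_cancel)
        then show "((\<lambda>s. (F (y + s *\<^sub>R e) - F y - s *\<^sub>R F' y) /\<^sub>R s + F' y) \<longlongrightarrow> F' y) (at 0)"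
          using tendsto_add[OF _ tendsto_const[of "F' y"]] by force
        show "\<forall>\<^sub>F s in at 0. (F (y + s *\<^sub>R e) - F y - s *\<^sub>R F' y) /\<^sub>R s + F' y
            = (F (y + s *\<^sub>R e) - F y) /\<^sub>R s"
          by (rule eventually_mono[OF eventually_neq_at_within[of 0]]) (simp add: scaleR_diff_right)
      qed
      moreover have "filterlim h (at 0) sequentially"
        unfolding filterlim_at using h0 h by (auto intro!: always_eventually simp: less_imp_neq[symmetric])
      ultimately show "(\<lambda>n. Q n y) \<longlonglongrightarrow> F' y"
        unfolding Q_def by (rule filterlim_compose)
    qed
    show "AE y in lborel. norm (Q n y) \<le> indicator (cball 0 (R + norm e)) y * M" for n
    proof (rule AE_I2)
      fix y
      show "norm (Q n y) \<le> indicator (cball 0 (R + norm e)) y * M"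
      proof (cases "norm y \<le> R + norm e")
        case True
        have "norm (Q n y) = inverse (h n) * norm (F (y + h n *\<^sub>R e) - F y)"
          using h[of n] by (simp add: Q_def)
        also have "\<dots> \<le> inverse (h n) * (M * h n)"
          using lip[of y "h n"] h[of n] by (intro mult_left_mono) auto
        also have "\<dots> = M" using h[of n] by simp
        finally show ?thesis using True by simp
      next
        case False
        have "norm y - norm (h n *\<^sub>R e) \<le> norm (y + h n *\<^sub>R e)"
          using norm_triangle_ineq2[of y "- (h n *\<^sub>R e)"] by simp
        moreover have "norm (h n *\<^sub>R e) \<le> norm e"
          using h[of n] by (simp add: mult_left_le_one_le)
        ultimately have "R < norm (y + h n *\<^sub>R e)" "R < norm y"
          using False norm_ge_zero[of e] by linarith+
        then show ?thesis using False by (simp add: Q_def suppF)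
      qed
    qed
  qed (auto simp: Q_def)
  ultimately show ?thesis
    by (simp add: LIMSEQ_const_iff)
qed

lemma continuous_on_extend_by_0:
  fixes g :: "'a::topological_space \<Rightarrow> 'b::real_normed_vector"
  assumes "open S" "closed K" "K \<subseteq> S" "continuous_on S g" "\<And>y. y \<notin> K \<Longrightarrow> g y = 0"
  shows "continuous_on UNIV g"
proof -
  have "continuous_on (- K) g"
    by (rule continuous_on_eq[of _ "\<lambda>_. 0"]) (use assms(5) in auto)
  then have "continuous_on (S \<union> - K) g"
    using assms by (intro continuous_on_open_Un) auto
  moreover have "S \<union> - K = UNIV" using assms by auto
  ultimately show ?thesis by simp
qed

text \<open>
  The derivative of \<open>U w1 - U1 w\<close> in the direction \<open>e\<close> is \<open>U w2 - U2 w\<close>, and it has integral \<open>0\<close>. The functions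
  \<open>U\<close> may be singular away from the support \<open>K\<close> of \<open>w\<close>.
\<close>

lemma Green_direction:
  fixes U U1 U2 w w1 w2 :: "'a::euclidean_space \<Rightarrow> complex"
  assumes S: "open S" and K: "closed K" "K \<subseteq> S" "K \<subseteq> cball 0 R"
    and U: "\<And>y. y \<in> S \<Longrightarrow> ((\<lambda>s. U (y + s *\<^sub>R e)) has_vector_derivative U1 y) (at 0)"
      "\<And>y. y \<in> S \<Longrightarrow> ((\<lambda>s. U1 (y + s *\<^sub>R e)) has_vector_derivative U2 y) (at 0)"
      "continuous_on S U" "continuous_on S U1" "continuous_on S U2"
    and w: "\<And>y. y \<in> S \<Longrightarrow> ((\<lambda>s. w (y + s *\<^sub>R e)) has_vector_derivative w1 y) (at 0)"
      "\<And>y. y \<in> S \<Longrightarrow> ((\<lambda>s. w1 (y + s *\<^sub>R e)) has_vector_derivative w2 y) (at 0)"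
      "continuous_on S w" "continuous_on S w1" "continuous_on S w2"
    and supp: "\<And>y. y \<notin> K \<Longrightarrow> w y = 0" "\<And>y. y \<notin> K \<Longrightarrow> w1 y = 0" "\<And>y. y \<notin> K \<Longrightarrow> w2 y = 0"
  shows "integrable lborel (\<lambda>y. U y * w2 y)" "integrable lborel (\<lambda>y. U2 y * w y)"
    and "(LINT y|lborel. U y * w2 y) = (LINT y|lborel. U2 y * w y)"
proof -
  have out: "y \<notin> K" if "R < norm y" for y
    using K that by auto
  note ext = continuous_on_extend_by_0[OF S K(1,2)]
  have c1: "continuous_on UNIV (\<lambda>y. U y * w2 y)" and c2: "continuous_on UNIV (\<lambda>y. U2 y * w y)"
    and c3: "continuous_on UNIV (\<lambda>y. U y * w1 y - U1 y * w y)"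
    by (rule ext; use U w supp in \<open>auto intro!: continuous_intros\<close>)+
  show i: "integrable lborel (\<lambda>y. U y * w2 y)" "integrable lborel (\<lambda>y. U2 y * w y)"
    by (rule integrable_continuous_bounded_support[OF c1, of R] integrable_continuous_bounded_support[OF c2, of R];
        simp add: out supp)+
  have "(LINT y|lborel. U y * w2 y - U2 y * w y) = 0"
  proof (rule integral_directional_derivative_eq_0[where F = "\<lambda>y. U y * w1 y - U1 y * w y" and e = e and R = R])
    fix y
    show "((\<lambda>s. U (y + s *\<^sub>R e) * w1 (y + s *\<^sub>R e) - U1 (y + s *\<^sub>R e) * w (y + s *\<^sub>R e))
        has_vector_derivative U y * w2 y - U2 y * w y) (at 0)"
    proof (cases "y \<in> S")
      case True
      show ?thesis
        by (rule derivative_eq_intros U(1)[OF True] U(2)[OF True] w(1)[OF True] w(2)[OF True] refl)+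
           (simp add: algebra_simps)
    next
      case False
      then have y: "y \<in> - K" using K by auto
      have "((\<lambda>s. y + s *\<^sub>R e) \<longlongrightarrow> y + 0 *\<^sub>R e) (at 0)"
        by (intro tendsto_intros)
      then have "\<forall>\<^sub>F s in at 0. y + s *\<^sub>R e \<in> - K"
        using K(1) y by (intro topological_tendstoD[of _ y]) auto
      then have ev: "\<forall>\<^sub>F s in nhds 0. U (y + s *\<^sub>R e) * w1 (y + s *\<^sub>R e) - U1 (y + s *\<^sub>R e) * w (y + s *\<^sub>R e) = 0"
        unfolding eventually_at_filter
        by (rule eventually_mono) (use y supp in \<open>force\<close>)
      have "((\<lambda>s::real. 0) has_vector_derivative (0::complex)) (at 0)"
        by (rule derivative_intros)
      moreover have "U y * w2 y - U2 y * w y = 0" using y supp by simp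
      ultimately show ?thesis
        using ev y supp
        by (subst has_vector_derivative_cong_ev[where g = "\<lambda>_. 0"]) auto
    qed
  qed (use c1 c2 c3 in \<open>auto intro!: continuous_intros simp: out supp\<close>)
  then show "(LINT y|lborel. U y * w2 y) = (LINT y|lborel. U2 y * w y)"
    using i by simp
qed

section \<open>Smooth profiles\<close>

text \<open>
  The bound \<open>T\<close> on the support is kept as a parameter because all profiles derived from one test
  function share it.
\<close>

definition bump :: "real \<Rightarrow> (real \<Rightarrow> real) \<Rightarrow> bool" where
  "bump T \<eta> \<longleftrightarrow> smooth \<eta> \<and> (\<forall>t. T < \<bar>t\<bar> \<longrightarrow> \<eta> t = 0)"

lemma smooth_DERIV:
  assumes "smooth f" shows "DERIV f t :> deriv f t"
proof -
  have "((deriv ^^ 0) f) differentiable_on UNIV" using assms unfolding smooth_def by blast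
  then show ?thesis
    by (simp add: differentiable_on_def DERIV_deriv_iff_real_differentiable)
qed

lemma smooth_deriv: "smooth f \<Longrightarrow> smooth (deriv f)"
  unfolding smooth_def by (metis funpow_Suc_right comp_apply)

text \<open>
  This replaces formulas for higher derivatives: for \<open>P\<close> one takes a class of expressions, such as the products of
  \<open>exp (a t)\<close> with smooth functions, whose derivatives visibly belong to the class.
\<close>

lemma smooth_coinduct:
  assumes "P f" and "\<And>f. P f \<Longrightarrow> \<exists>g. P g \<and> (\<forall>t. DERIV f t :> g t)"
  shows "smooth f"
proof -
  have "P ((deriv ^^ k) f)" for k
  proof (induction k)
    case (Suc k)
    then obtain g where g: "P g" "\<And>t. DERIV ((deriv ^^ k) f) t :> g t"
      using assms(2) by blast
    then have "deriv ((deriv ^^ k) f) = g" by (auto intro: DERIV_imp_deriv)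
    then show ?case using g by simp
  qed (use assms(1) in simp)
  then show ?thesis
    unfolding smooth_def using assms(2)
    by (auto simp: differentiable_on_def) (meson real_differentiable_def)
qed

lemma smooth_add_smult:
  assumes "smooth f" "smooth g"
  shows "smooth (\<lambda>t. f t + c * g t)"
proof (rule smooth_coinduct[where P = "\<lambda>h. \<exists>f g. smooth f \<and> smooth g \<and> h = (\<lambda>t. f t + c * g t)"])
  fix h assume "\<exists>f g. smooth f \<and> smooth g \<and> h = (\<lambda>t. f t + c * g t)"
  then obtain f g where fg: "smooth f" "smooth g" "h = (\<lambda>t. f t + c * g t)" by blast
  have "DERIV h t :> deriv f t + c * deriv g t" for t
    unfolding fg(3) by (rule derivative_eq_intros smooth_DERIV fg refl)+ simp
  then show "\<exists>h'. (\<exists>f g. smooth f \<and> smooth g \<and> h' = (\<lambda>t. f t + c * g t)) \<and> (\<forall>t. DERIV h t :> h' t)"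
    using fg smooth_deriv by blast
qed (use assms in blast)

lemma smooth_exp_mult:
  assumes "smooth f"
  shows "smooth (\<lambda>t. exp (a * t) * f t)"
proof (rule smooth_coinduct[where P = "\<lambda>h. \<exists>f. smooth f \<and> h = (\<lambda>t. exp (a * t) * f t)"])
  fix h assume "\<exists>f. smooth f \<and> h = (\<lambda>t. exp (a * t) * f t)"
  then obtain f where f: "smooth f" "h = (\<lambda>t. exp (a * t) * f t)" by blast
  have "DERIV h t :> exp (a * t) * (deriv f t + a * f t)" for t
    unfolding f(2) by (rule derivative_eq_intros smooth_DERIV f refl)+ (simp add: algebra_simps)
  moreover have "smooth (\<lambda>t. deriv f t + a * f t)"
    using f by (intro smooth_add_smult smooth_deriv)
  ultimately show "\<exists>h'. (\<exists>f. smooth f \<and> h' = (\<lambda>t. exp (a * t) * f t)) \<and> (\<forall>t. DERIV h t :> h' t)"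
    by blast
qed (use assms in blast)

lemma bump_deriv:
  assumes "bump T \<eta>" shows "bump T (deriv \<eta>)"
proof -
  have "deriv \<eta> t = 0" if "T < \<bar>t\<bar>" for t
  proof -
    have "open {s::real. T < \<bar>s\<bar>}"
      by (intro open_Collect_less continuous_intros)
    moreover have "t \<in> {s. T < \<bar>s\<bar>}" using that by simp
    ultimately have "DERIV \<eta> t :> 0 \<longleftrightarrow> DERIV (\<lambda>_. 0) t :> (0::real)"
      using assms by (intro DERIV_cong_ev refl) (auto simp: bump_def eventually_nhds)
    then show ?thesis by (auto intro: DERIV_imp_deriv)
  qed
  then show ?thesis using assms by (simp add: bump_def smooth_deriv)
qed

lemma bump_exp_mult: "bump T \<eta> \<Longrightarrow> bump T (\<lambda>t. exp (a * t) * \<eta> t)"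
  by (simp add: bump_def smooth_exp_mult)

lemma bump_add_smult: "bump T \<eta> \<Longrightarrow> bump T \<zeta> \<Longrightarrow> bump T (\<lambda>t. \<eta> t + c * \<zeta> t)"
  by (simp add: bump_def smooth_add_smult)

lemma bump_continuous: "bump T \<eta> \<Longrightarrow> continuous_on A \<eta>"
  by (auto simp: bump_def intro!: continuous_at_imp_continuous_on DERIV_isCont smooth_DERIV)

lemma test_function_imp_bump:
  assumes "test_function \<phi>"
  obtains T where "bump T \<phi>"
proof -
  have "bounded (closure {t. \<phi> t \<noteq> 0})"
    using assms compact_imp_bounded by (auto simp: test_function_def)
  then obtain T where T: "\<And>t. t \<in> closure {t. \<phi> t \<noteq> 0} \<Longrightarrow> norm t \<le> T"
    unfolding bounded_iff by blast
  have "\<phi> t = 0" if "T < \<bar>t\<bar>" for t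
    using T[of t] that closure_subset[of "{t. \<phi> t \<noteq> 0}"] by fastforce
  then show ?thesis
    using assms that by (auto simp: bump_def test_function_def)
qed

section \<open>Radial functions and their Laplacian\<close>

text \<open>
  In the variable \<open>t = - ln |y|\<close> the gradient of \<open>\<eta> t\<close> is \<open>- exp (2 t) \<eta>' t\<close> times the vector \<open>y\<close>.
\<close>

definition gradient_profile :: "(real \<Rightarrow> real) \<Rightarrow> real \<Rightarrow> real" where
  "gradient_profile \<eta> t = exp (2 * t) * deriv \<eta> t"

text \<open>
  The profile of the Laplacian in dimension \<open>n\<close>, that is \<open>exp (2 t) (\<eta>'' t - (n - 2) \<eta>' t)\<close>. It is written through the
  gradient because two applications of the product rule give it in this form, with
  \<open>exp (- 2 t) = |y|\<^sup>2\<close>.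
\<close>

definition laplacian_profile :: "nat \<Rightarrow> (real \<Rightarrow> real) \<Rightarrow> real \<Rightarrow> real" where
  "laplacian_profile n \<eta> t = exp (- 2 * t) * gradient_profile (gradient_profile \<eta>) t + - real n * gradient_profile \<eta> t"

lemma bump_gradient_profile: "bump T \<eta> \<Longrightarrow> bump T (gradient_profile \<eta>)"
  unfolding gradient_profile_def[abs_def] by (intro bump_exp_mult bump_deriv)

lemma bump_laplacian: "bump T \<eta> \<Longrightarrow> bump T (laplacian_profile n \<eta>)"
  unfolding laplacian_profile_def[abs_def] by (intro bump_add_smult bump_exp_mult bump_gradient_profile)

text \<open>
  The value \<open>0\<close> at the origin makes the function continuous when \<open>\<eta>\<close> has compact support; without the case
  distinction \<open>ln 0 = 0\<close> would give \<open>\<eta> 0\<close> there.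
\<close>

definition radial :: "(real \<Rightarrow> real) \<Rightarrow> 'a::real_normed_vector \<Rightarrow> complex" where
  "radial \<eta> x = (if x = 0 then 0 else of_real (\<eta> (- ln (norm x))))"

lemma ln_norm_directional_derivative:
  fixes y e :: "'a::real_inner"
  assumes y: "y \<noteq> 0"
  shows "((\<lambda>s. ln (norm (y + s *\<^sub>R e))) has_real_derivative (y \<bullet> e) * exp (- 2 * ln (norm y))) (at 0)"
proof -
  have eq: "ln (norm (y + s *\<^sub>R e)) = ln (y \<bullet> y + 2 * s * (y \<bullet> e) + s\<^sup>2 * (e \<bullet> e)) / 2" for s
  proof -
    have "y \<bullet> y + 2 * s * (y \<bullet> e) + s\<^sup>2 * (e \<bullet> e) = (norm (y + s *\<^sub>R e))\<^sup>2"
      unfolding power2_norm_eq_inner by (simp add: inner_simps power2_eq_square inner_commute algebra_simps)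
    moreover have "ln ((norm x)\<^sup>2) = 2 * ln (norm x)" for x :: 'a
      by (cases "x = 0") (simp_all add: ln_realpow)
    ultimately show ?thesis by simp
  qed
  have "exp (- 2 * ln (norm y)) = 1 / (norm y)\<^sup>2"
  proof -
    have "exp (ln (norm y)) = norm y" using y by simp
    moreover have "exp (- 2 * ln (norm y)) * (exp (ln (norm y)) * exp (ln (norm y))) = 1"
      by (simp flip: exp_add)
    ultimately show ?thesis
      using y by (simp add: eq_divide_eq power2_eq_square)
  qed
  then have e: "(y \<bullet> e) * exp (- 2 * ln (norm y)) = (y \<bullet> e) / (y \<bullet> y)"
    by (simp add: power2_norm_eq_inner)
  have "0 < y \<bullet> y" using y by simp
  then show ?thesis
    unfolding eq e by (auto intro!: derivative_eq_intros simp: field_simps)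
qed

lemma eventually_line_nonzero:
  fixes y e :: "'a::real_normed_vector"
  assumes "y \<noteq> 0"
  shows "\<forall>\<^sub>F s in nhds 0. y + s *\<^sub>R e \<noteq> 0"
proof -
  have "((\<lambda>s. y + s *\<^sub>R e) \<longlongrightarrow> y + 0 *\<^sub>R e) (nhds 0)"
    by (intro tendsto_intros filterlim_ident)
  then show ?thesis
    using assms tendsto_imp_eventually_ne by force
qed

lemma radial_directional_derivative:
  fixes y e :: "'a::real_inner"
  assumes \<eta>: "bump T \<eta>" and y: "y \<noteq> 0"
  shows "((\<lambda>s. radial \<eta> (y + s *\<^sub>R e)) has_vector_derivative of_real (- (y \<bullet> e)) * radial (gradient_profile \<eta>) y) (at 0)"
proof -
  have sm: "smooth \<eta>" using \<eta> by (simp add: bump_def)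
  have "((\<lambda>s. \<eta> (- ln (norm (y + s *\<^sub>R e)))) has_real_derivative
      deriv \<eta> (- ln (norm y)) * (- ((y \<bullet> e) * exp (- 2 * ln (norm y))))) (at 0)"
    by (rule DERIV_chain2[where f = \<eta> and g = "\<lambda>s. - ln (norm (y + s *\<^sub>R e))"])
       (use smooth_DERIV[OF sm, of "- ln (norm y)"] ln_norm_directional_derivative[OF y, of e] in
         \<open>auto intro!: DERIV_minus\<close>)
  then have d: "((\<lambda>s. complex_of_real (\<eta> (- ln (norm (y + s *\<^sub>R e))))) has_vector_derivative
      of_real (deriv \<eta> (- ln (norm y)) * (- ((y \<bullet> e) * exp (- 2 * ln (norm y)))))) (at 0)"
    by (intro has_vector_derivative_of_real) (simp add: has_real_derivative_iff_has_vector_derivative)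
  have ev: "\<forall>\<^sub>F s in nhds 0. complex_of_real (\<eta> (- ln (norm (y + s *\<^sub>R e)))) = radial \<eta> (y + s *\<^sub>R e)"
    using eventually_line_nonzero[OF y, of e] by eventually_elim (simp add: radial_def)
  have "((\<lambda>s. complex_of_real (\<eta> (- ln (norm (y + s *\<^sub>R e))))) has_vector_derivative v) (at 0)
      = ((\<lambda>s. radial \<eta> (y + s *\<^sub>R e)) has_vector_derivative v) (at 0)" for v
    by (rule has_vector_derivative_cong_ev) (use ev y in \<open>simp_all add: radial_def\<close>)
  then have "((\<lambda>s. radial \<eta> (y + s *\<^sub>R e)) has_vector_derivative
      of_real (deriv \<eta> (- ln (norm y)) * (- ((y \<bullet> e) * exp (- 2 * ln (norm y)))))) (at 0)"
    using d by blast
  then show ?thesis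
    using y by (simp add: radial_def gradient_profile_def mult_ac)
qed

lemma npow_directional_derivative:
  fixes y e :: "'a::real_inner"
  assumes y: "y \<noteq> 0"
  shows "((\<lambda>s. npow z (y + s *\<^sub>R e)) has_vector_derivative z * of_real (y \<bullet> e) * npow (z - 2) y) (at 0)"
proof -
  have "((\<lambda>s. complex_of_real (ln (norm (y + s *\<^sub>R e)))) has_vector_derivative
      of_real ((y \<bullet> e) * exp (- 2 * ln (norm y)))) (at 0)"
    using ln_norm_directional_derivative[OF y, of e]
    by (intro has_vector_derivative_of_real) (simp add: has_real_derivative_iff_has_vector_derivative)
  then have "((\<lambda>s. npow z (y + s *\<^sub>R e)) has_vector_derivative
      of_real ((y \<bullet> e) * exp (- 2 * ln (norm y))) * (z * exp (z * of_real (ln (norm (y + 0 *\<^sub>R e)))))) (at 0)"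
    unfolding npow_def
    by (rule field_vector_diff_chain_at[where g = "\<lambda>w. exp (z * w)", unfolded o_def])
       (auto intro!: derivative_eq_intros)
  moreover have "npow (z - 2) y = npow z y * of_real (exp (- 2 * ln (norm y)))"
    using npow_add[of z "- 2" y] by (simp add: npow_def flip: exp_of_real)
  ultimately show ?thesis
    by (simp add: npow_def mult_ac)
qed

lemma radial_eq_0_outside:
  assumes "bump T \<eta>" "y \<notin> {y. exp (- T) \<le> norm y \<and> norm y \<le> exp T}"
  shows "radial \<eta> y = 0"
proof (cases "y = 0")
  case False
  then have "T < \<bar>- ln (norm y)\<bar>"
    using assms(2) ln_less_cancel_iff[of "norm y" "exp (- T)"] ln_less_cancel_iff[of "exp T" "norm y"]
    by (auto simp: not_le)
  then show ?thesis using assms(1) False by (simp add: radial_def bump_def)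
qed (simp add: radial_def)

lemma continuous_on_radial':
  assumes "bump T \<eta>"
  shows "continuous_on (- {0}) (radial \<eta>)"
proof (rule continuous_on_eq)
  show "continuous_on (- {0}) (\<lambda>x::'a::real_normed_vector. complex_of_real (\<eta> (- ln (norm x))))"
    by (intro continuous_intros continuous_on_compose2[OF bump_continuous[OF assms, of UNIV]]) auto
qed (simp add: radial_def)

lemma closed_annulus: "closed {y::'a::real_normed_vector. a \<le> norm y \<and> norm y \<le> b}"
  by (intro closed_Collect_conj closed_Collect_le continuous_intros)

lemma continuous_on_radial:
  assumes "bump T \<eta>"
  shows "continuous_on UNIV (radial \<eta> :: 'a::real_normed_vector \<Rightarrow> complex)"
proof (rule continuous_on_extend_by_0[OF _ closed_annulus _ continuous_on_radial'[OF assms]])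
  show "{y::'a. exp (- T) \<le> norm y \<and> norm y \<le> exp T} \<subseteq> - {0}"
    using exp_gt_zero[of "- T"] by (auto simp del: exp_gt_zero)
qed (use radial_eq_0_outside[OF assms] in auto)

lemma borel_measurable_radial:
  "bump T \<eta> \<Longrightarrow> (radial \<eta> :: 'a::euclidean_space \<Rightarrow> complex) \<in> borel_measurable borel"
  by (intro borel_measurable_continuous_onI continuous_on_radial)

lemma integrable_radial:
  assumes "bump T \<eta>"
  shows "integrable lborel (radial \<eta> :: 'a::euclidean_space \<Rightarrow> complex)"
  by (rule integrable_continuous_bounded_support[OF continuous_on_radial[OF assms], of "exp T"])
     (rule radial_eq_0_outside[OF assms], simp)

text \<open>
  Green's formula in each direction of the basis, summed up. The Laplacian of \<open>U\<close> appears as a sum of second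
  derivatives, so the formula applies to plane waves as well as to powers of the distance to a point.
\<close>

lemma radial_Green:
  fixes U :: "'a::euclidean_space \<Rightarrow> complex" and dU ddU :: "'a \<Rightarrow> 'a \<Rightarrow> complex"
  assumes \<eta>: "bump T \<eta>" and S: "open S" "{y. exp (- T) \<le> norm y \<and> norm y \<le> exp T} \<subseteq> S" "S \<subseteq> - {0}"
    and U: "\<And>e y. e \<in> Basis \<Longrightarrow> y \<in> S \<Longrightarrow> ((\<lambda>s. U (y + s *\<^sub>R e)) has_vector_derivative dU e y) (at 0)"
      "\<And>e y. e \<in> Basis \<Longrightarrow> y \<in> S \<Longrightarrow> ((\<lambda>s. dU e (y + s *\<^sub>R e)) has_vector_derivative ddU e y) (at 0)"
      "continuous_on S U" "\<And>e. e \<in> Basis \<Longrightarrow> continuous_on S (dU e)" "\<And>e. e \<in> Basis \<Longrightarrow> continuous_on S (ddU e)"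
  shows "(LINT y|lborel. U y * radial (laplacian_profile DIM('a) \<eta>) y) = (LINT y|lborel. (\<Sum>e\<in>Basis. ddU e y) * radial \<eta> y)"
proof -
  define w1 where "w1 e y = of_real (- (y \<bullet> e)) * radial (gradient_profile \<eta>) y" for e y :: 'a
  define w2 where "w2 e y = - radial (gradient_profile \<eta>) y + of_real ((y \<bullet> e)\<^sup>2) * radial (gradient_profile (gradient_profile \<eta>)) y" for e y :: 'a
  note b = \<eta> bump_gradient_profile[OF \<eta>] bump_gradient_profile[OF bump_gradient_profile[OF \<eta>]]
  let ?K = "{y::'a. exp (- T) \<le> norm y \<and> norm y \<le> exp T}"
  have c: "continuous_on S (radial \<eta>)" "continuous_on S (radial (gradient_profile \<eta>))" "continuous_on S (radial (gradient_profile (gradient_profile \<eta>)))"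
    using b by (auto intro: continuous_on_subset[OF continuous_on_radial])
  have G: "integrable lborel (\<lambda>y. U y * w2 e y) \<and> integrable lborel (\<lambda>y. ddU e y * radial \<eta> y)
      \<and> (LINT y|lborel. U y * w2 e y) = (LINT y|lborel. ddU e y * radial \<eta> y)" if e: "e \<in> Basis" for e
  proof -
    have Kc: "?K \<subseteq> cball 0 (exp T)" by auto
    have d1: "((\<lambda>s. radial \<eta> (y + s *\<^sub>R e)) has_vector_derivative w1 e y) (at 0)" if "y \<in> S" for y
      unfolding w1_def by (rule radial_directional_derivative[OF \<eta>]) (use that S in auto)
    have d2: "((\<lambda>s. w1 e (y + s *\<^sub>R e)) has_vector_derivative w2 e y) (at 0)" if "y \<in> S" for y
    proof -
      have "((\<lambda>s. - ((y + s *\<^sub>R e) \<bullet> e)) has_vector_derivative - 1) (at 0)"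
        using e unfolding inner_add_left inner_scaleR_left
        by (auto intro!: derivative_eq_intros)
      then have "((\<lambda>s. complex_of_real (- ((y + s *\<^sub>R e) \<bullet> e))) has_vector_derivative of_real (- 1)) (at 0)"
        by (intro has_vector_derivative_of_real) (simp add: has_real_derivative_iff_has_vector_derivative)
      from has_vector_derivative_mult[OF this radial_directional_derivative[OF b(2)], of y e]
      show ?thesis
        unfolding w1_def w2_def using that S by (auto simp: power2_eq_square algebra_simps)
    qed
    have c1: "continuous_on S (w1 e)" and c2: "continuous_on S (w2 e)"
      unfolding w1_def w2_def by (intro continuous_intros c)+
    have s: "radial \<eta> y = 0" "w1 e y = 0" "w2 e y = 0" if "y \<notin> ?K" for y
      using radial_eq_0_outside[OF b(1) that] radial_eq_0_outside[OF b(2) that] radial_eq_0_outside[OF b(3) that]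
      by (simp_all add: w1_def w2_def)
    show ?thesis
      using Green_direction[OF S(1) closed_annulus S(2) Kc U(1)[OF e] U(2)[OF e] U(3) U(4)[OF e] U(5)[OF e]
          d1 d2 c(1) c1 c2 s] by blast
  qed
  have w2_sum: "radial (laplacian_profile DIM('a) \<eta>) y = (\<Sum>e\<in>Basis. w2 e y)" for y :: 'a
  proof (cases "y = 0")
    case False
    have "(\<Sum>e\<in>Basis. (y \<bullet> e)\<^sup>2) = (norm y)\<^sup>2"
      unfolding power2_norm_eq_inner by (subst euclidean_inner[of y y]) (simp add: power2_eq_square)
    moreover have "exp (- 2 * - ln (norm y)) = (norm y)\<^sup>2"
      using False ln_realpow[of "norm y" 2] by (metis exp_ln minus_mult_minus of_nat_numeral zero_less_norm_iff zero_less_power)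
    ultimately show ?thesis
      using False unfolding w2_def sum.distrib sum_distrib_right[symmetric] of_real_sum[symmetric]
      by (simp add: laplacian_profile_def radial_def)
  qed (simp add: w2_def radial_def)
  have "(LINT y|lborel. U y * radial (laplacian_profile DIM('a) \<eta>) y) = (\<Sum>e\<in>Basis. LINT y|lborel. U y * w2 e y)"
    unfolding w2_sum sum_distrib_left by (rule Bochner_Integration.integral_sum) (use G in auto)
  also have "\<dots> = (\<Sum>e\<in>Basis. LINT y|lborel. ddU e y * radial \<eta> y)"
    by (rule sum.cong) (use G in auto)
  also have "\<dots> = (LINT y|lborel. (\<Sum>e\<in>Basis. ddU e y) * radial \<eta> y)"
    unfolding sum_distrib_right by (rule Bochner_Integration.integral_sum[symmetric]) (use G in auto)
  finally show ?thesis .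
qed

section \<open>Decay of the Fourier transform of a radial function\<close>

text \<open>
  Green's formula against the plane wave \<open>cis (- (y \<bullet> \<xi>))\<close>.
\<close>

lemma fourier_radial_laplacian:
  fixes \<xi> :: "real ^ 'n"
  assumes \<eta>: "bump T \<eta>"
  shows "fourier (radial (laplacian_profile CARD('n) \<eta>)) \<xi> = of_real (- (norm \<xi>)\<^sup>2) * fourier (radial \<eta>) \<xi>"
proof -
  define U where "U y = cis (- (y \<bullet> \<xi>))" for y :: "real^'n"
  have dU: "((\<lambda>s. U (y + s *\<^sub>R e)) has_vector_derivative (- \<i> * of_real (e \<bullet> \<xi>)) * U y) (at 0)" for y e
  proof -
    have "((\<lambda>s. exp (\<i> * of_real (- (y \<bullet> \<xi>)) + of_real s * (- \<i> * of_real (e \<bullet> \<xi>)))) has_vector_derivative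
        (- \<i> * of_real (e \<bullet> \<xi>)) * U y) (at 0)"
      unfolding U_def cis_conv_exp
      by (rule has_vector_derivative_eq_rhs, rule has_vector_derivative_real_field)
         (auto intro!: derivative_eq_intros)
    then show ?thesis
      unfolding U_def cis_conv_exp by (simp add: inner_add_left algebra_simps)
  qed
  have cU: "continuous_on S U" for S
    unfolding U_def by (intro continuous_intros)
  have sub: "{y::real^'n. exp (- T) \<le> norm y \<and> norm y \<le> exp T} \<subseteq> - {0}"
    using exp_gt_zero[of "- T"] by (auto simp del: exp_gt_zero)
  have sum: "(\<Sum>e\<in>Basis. (- \<i> * of_real (e \<bullet> \<xi>))\<^sup>2 * U y) = of_real (- (norm \<xi>)\<^sup>2) * U y" for y
  proof -
    have "(norm \<xi>)\<^sup>2 = (\<Sum>e\<in>Basis. (e \<bullet> \<xi>)\<^sup>2)"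
      unfolding power2_norm_eq_inner by (subst euclidean_inner[of \<xi> \<xi>]) (simp add: power2_eq_square inner_commute)
    then show ?thesis
      by (simp add: power_mult_distrib sum_negf sum_distrib_right)
  qed
  have "fourier (radial (laplacian_profile CARD('n) \<eta>)) \<xi> = (LINT y|lborel. U y * radial (laplacian_profile DIM(real^'n) \<eta>) y)"
    by (simp add: fourier_def U_def mult.commute)
  also have "\<dots> = (LINT y|lborel. (\<Sum>e\<in>Basis. (- \<i> * of_real (e \<bullet> \<xi>))\<^sup>2 * U y) * radial \<eta> y)"
  proof (rule radial_Green[OF \<eta>, where S = "- {0}" and dU = "\<lambda>e y. - \<i> * of_real (e \<bullet> \<xi>) * U y"])
    fix e y :: "real^'n"
    show "((\<lambda>s. - \<i> * of_real (e \<bullet> \<xi>) * U (y + s *\<^sub>R e)) has_vector_derivative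
        (- \<i> * of_real (e \<bullet> \<xi>))\<^sup>2 * U y) (at 0)"
      using has_vector_derivative_mult_right[OF dU[of y e], of "- \<i> * of_real (e \<bullet> \<xi>)"]
      by (simp add: power2_eq_square mult.assoc)
  qed (use sub dU in \<open>auto intro!: continuous_intros cU\<close>)
  also have "\<dots> = of_real (- (norm \<xi>)\<^sup>2) * fourier (radial \<eta>) \<xi>"
    unfolding sum mult.assoc Bochner_Integration.integral_mult_right_zero by (simp only: fourier_def U_def mult.commute)
  finally show ?thesis .
qed

lemma bump_laplacian_power: "bump T \<eta> \<Longrightarrow> bump T ((laplacian_profile n ^^ k) \<eta>)"
  by (induction k) (auto intro: bump_laplacian)

lemma fourier_radial_laplacian_power:
  fixes \<xi> :: "real ^ 'n"
  assumes \<eta>: "bump T \<eta>"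
  shows "fourier (radial ((laplacian_profile CARD('n) ^^ k) \<eta>)) \<xi> = of_real ((- (norm \<xi>)\<^sup>2) ^ k) * fourier (radial \<eta>) \<xi>"
  by (induction k) (simp_all add: fourier_radial_laplacian[OF bump_laplacian_power[OF \<eta>]])

text \<open>
  The Fourier transform of a power of the Laplacian is bounded, since the latter is again an integrable
  radial function. Dividing by the power of \<open>|\<xi>|\<close> gives decay of any order.
\<close>

lemma fourier_radial_decay:
  assumes \<eta>: "bump T \<eta>"
  shows "\<exists>C. \<forall>\<xi>::real^'n. norm (fourier (radial \<eta>) \<xi>) \<le> C
            \<and> (\<xi> \<noteq> 0 \<longrightarrow> norm (fourier (radial \<eta>) \<xi>) \<le> C * exp (- real (2 * k) * ln (norm \<xi>)))"
proof -
  define C1 where "C1 = (LINT x::real^'n|lborel. norm (radial \<eta> x :: complex))"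
  define C2 where "C2 = (LINT x::real^'n|lborel. norm (radial ((laplacian_profile CARD('n) ^^ k) \<eta>) x :: complex))"
  have "norm (fourier (radial \<eta>) \<xi>) \<le> max C1 C2 * exp (- real (2 * k) * ln (norm \<xi>))"
    if "\<xi> \<noteq> 0" for \<xi> :: "real^'n"
  proof -
    have e: "exp (real (2 * k) * ln (norm \<xi>)) = (norm \<xi>)\<^sup>2 ^ k"
      unfolding exp_of_nat_mult power_mult using that by simp
    have "norm (fourier (radial ((laplacian_profile CARD('n) ^^ k) \<eta>)) \<xi>) \<le> C2"
      unfolding C2_def by (rule norm_fourier_le)
    then have "exp (real (2 * k) * ln (norm \<xi>)) * norm (fourier (radial \<eta>) \<xi>) \<le> max C1 C2"
      unfolding fourier_radial_laplacian_power[OF \<eta>] e by (simp add: norm_mult norm_power)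
    then have "exp (- real (2 * k) * ln (norm \<xi>)) * (exp (real (2 * k) * ln (norm \<xi>)) * norm (fourier (radial \<eta>) \<xi>))
        \<le> exp (- real (2 * k) * ln (norm \<xi>)) * max C1 C2"
      by (rule mult_left_mono) simp
    then show ?thesis
      unfolding mult.assoc[symmetric] exp_add[symmetric] by (simp add: mult.commute)
  qed
  moreover have "norm (fourier (radial \<eta>) \<xi>) \<le> max C1 C2" for \<xi> :: "real^'n"
    using norm_fourier_le[of "radial \<eta>" \<xi>] by (simp add: C1_def)
  ultimately show ?thesis by blast
qed

section \<open>Integrability against powers of the norm\<close>

lemma integrable_exp_abs:
  fixes d :: real
  assumes "0 < d"
  shows "integrable lborel (\<lambda>t. exp (- d * \<bar>t\<bar>))"
proof -
  have "(\<integral>\<^sup>+t. ennreal (exp (- d * t)) * indicator {0..} t \<partial>lborel) = 0 - (- exp (- d * 0) / d)"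
  proof (rule nn_integral_FTC_atLeast)
    show "((\<lambda>t. - exp (- d * t) / d) \<longlongrightarrow> 0) at_top"
      using assms by real_asymp
  qed (use assms in \<open>auto intro!: derivative_eq_intros\<close>)
  also have "(\<integral>\<^sup>+t. ennreal (exp (- d * t)) * indicator {0..} t \<partial>lborel)
      = (\<integral>\<^sup>+t. ennreal (indicator {0..} t * exp (- d * t)) \<partial>lborel)"
    by (intro nn_integral_cong) (auto split: split_indicator)
  finally have 1: "integrable lborel (\<lambda>t. indicator {0..} t * exp (- d * t))"
    by (intro integrableI_nonneg) auto
  have 2: "integrable lborel (\<lambda>t. indicator {0..} (0 + (-1) * t) * exp (- d * (0 + (-1) * t)))"
    by (rule lborel_integrable_real_affine[OF 1]) simp
  show ?thesis
    by (rule Bochner_Integration.integrable_bound[OF Bochner_Integration.integrable_add[OF 1 2]])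
       (auto intro!: AE_I2 split: split_indicator)
qed

text \<open>
  After passing to \<open>t = - ln |x|\<close> the two bounds on \<open>h\<close> give a majorant that decays exponentially at both ends of
  the line: boundedness serves for \<open>x\<close> near the origin, decay of order \<open>b\<close> for large \<open>x\<close>.
\<close>

lemma integrable_npow_decay:
  fixes h :: "'a::euclidean_space \<Rightarrow> complex"
  assumes h[measurable]: "h \<in> borel_measurable borel"
    and bound: "\<And>x. norm (h x) \<le> C" "\<And>x. x \<noteq> 0 \<Longrightarrow> norm (h x) \<le> C' * exp (- b * ln (norm x))"
    and z: "0 < Re z + DIM('a)" "Re z + DIM('a) < b"
  shows "integrable lborel (\<lambda>x. npow z x * h x)"
proof -
  define c where "c = Re z + DIM('a)"
  define M where "M = max C (max C' 0)"
  define d where "d = min c (b - c)"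
  define F where "F t = complex_of_real (exp (- Re z * t) * (M * min 1 (exp (b * t))))" for t
  have [measurable]: "F \<in> borel_measurable borel" unfolding F_def by measurable
  have "integrable lborel (\<lambda>t. of_real (exp (- real DIM('a) * t)) * F t)"
  proof (rule Bochner_Integration.integrable_bound)
    show "integrable lborel (\<lambda>t. M * exp (- d * \<bar>t\<bar>))"
      using z by (intro integrable_mult_right integrable_exp_abs) (auto simp: d_def c_def)
    have "exp (- real DIM('a) * t) * (exp (- Re z * t) * (M * min 1 (exp (b * t)))) \<le> M * exp (- d * \<bar>t\<bar>)" for t
    proof -
      have "exp (- c * t) * min 1 (exp (b * t)) \<le> exp (- d * \<bar>t\<bar>)"
      proof (cases "0 \<le> t")
        case True
        have "exp (- c * t) * min 1 (exp (b * t)) \<le> exp (- c * t) * 1"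
          by (intro mult_left_mono) auto
        also have "\<dots> \<le> exp (- d * \<bar>t\<bar>)"
          using True by (auto simp: d_def intro: mult_right_mono)
        finally show ?thesis .
      next
        case False
        have "exp (- c * t) * min 1 (exp (b * t)) \<le> exp (- c * t) * exp (b * t)"
          by (intro mult_left_mono) auto
        also have "\<dots> = exp ((b - c) * t)"
          unfolding exp_add[symmetric] by (simp add: algebra_simps)
        also have "\<dots> \<le> exp (- d * \<bar>t\<bar>)"
          using False by (auto simp: d_def intro: mult_right_mono_neg)
        finally show ?thesis .
      qed
      then have "M * (exp (- c * t) * min 1 (exp (b * t))) \<le> M * exp (- d * \<bar>t\<bar>)"
        by (intro mult_left_mono) (auto simp: M_def)
      moreover have "exp (- c * t) = exp (- real DIM('a) * t) * exp (- Re z * t)"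
        unfolding exp_add[symmetric] by (simp add: c_def algebra_simps)
      ultimately show ?thesis by (simp add: mult_ac)
    qed
    moreover have "0 \<le> M" by (simp add: M_def)
    ultimately show "AE t in lborel. norm (of_real (exp (- real DIM('a) * t)) * F t) \<le> norm (M * exp (- d * \<bar>t\<bar>))"
      by (intro AE_I2) (simp add: F_def norm_mult abs_mult)
  qed measurable
  then have int: "integrable lborel (\<lambda>x::'a. F (- ln (norm x)))"
    by (subst integrable_radial_iff) auto
  show ?thesis
  proof (rule Bochner_Integration.integrable_bound[OF int])
    show "AE x in lborel. norm (npow z x * h x) \<le> norm (F (- ln (norm x)))"
      using AE_lborel_singleton[of "0::'a"]
    proof eventually_elim
      case (elim x)
      have "norm (h x) \<le> M"
        using bound(1)[of x] by (simp add: M_def)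
      moreover have "norm (h x) \<le> M * exp (- b * ln (norm x))"
        by (rule order_trans[OF bound(2)[OF elim] mult_right_mono]) (simp_all add: M_def)
      moreover have "0 \<le> M" by (simp add: M_def)
      ultimately have "norm (h x) \<le> M * min 1 (exp (- b * ln (norm x)))"
        by (simp add: min_def)
      then show ?case
        using \<open>0 \<le> M\<close> by (simp add: F_def norm_mult norm_npow abs_mult mult_left_mono)
    qed
  qed measurable
qed

lemma integrable_npow_bounded_support:
  fixes h :: "'a::euclidean_space \<Rightarrow> complex"
  assumes h: "h \<in> borel_measurable borel"
    and bound: "\<And>x. norm (h x) \<le> C" and supp: "\<And>x. R < norm x \<Longrightarrow> h x = 0"
    and z: "0 < Re z + DIM('a)"
  shows "integrable lborel (\<lambda>x. npow z x * h x)"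
proof (rule integrable_npow_decay[OF h bound])
  define b where "b = Re z + DIM('a) + 1"
  show "norm (h x) \<le> (C * exp (b * ln (max R 1))) * exp (- b * ln (norm x))" if "x \<noteq> 0" for x
  proof (cases "R < norm x")
    case True
    then show ?thesis using supp bound[of x] by simp
  next
    case False
    then have "ln (norm x) \<le> ln (max R 1)"
      using that by simp
    then have "1 \<le> exp (b * ln (max R 1)) * exp (- b * ln (norm x))"
    proof -
      have "0 \<le> b * (ln (max R 1) - ln (norm x))"
        using z \<open>ln (norm x) \<le> _\<close> by (intro mult_nonneg_nonneg) (auto simp: b_def)
      then show ?thesis unfolding exp_add[symmetric] by (simp add: algebra_simps)
    qed
    then have "C * 1 \<le> C * (exp (b * ln (max R 1)) * exp (- b * ln (norm x)))"
      using order_trans[OF norm_ge_zero bound[of x]] by (intro mult_left_mono)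
    then show ?thesis using bound[of x] by (simp add: mult.assoc)
  qed
  show "Re z + DIM('a) < b" by (simp add: b_def)
qed (use z in auto)

section \<open>Rotation invariance of Lebesgue measure\<close>

lemma nn_integral_lborel_translate:
  fixes g :: "'a::euclidean_space \<Rightarrow> ennreal"
  assumes [measurable]: "g \<in> borel_measurable borel"
  shows "(\<integral>\<^sup>+y. g (c + y) \<partial>lborel) = (\<integral>\<^sup>+y. g y \<partial>lborel)"
proof -
  have "(\<integral>\<^sup>+y. g y \<partial>distr lborel borel ((+) c)) = (\<integral>\<^sup>+y. g (c + y) \<partial>lborel)"
    by (rule nn_integral_distr) simp_all
  then show ?thesis by (simp add: lborel_distr_plus)
qed

text \<open>
  Compute the double integral of \<open>h x * g (f y + x)\<close> in two ways, where \<open>h\<close> is the indicator of the unit ball and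
  \<open>g\<close> that of \<open>A\<close>. Translating \<open>y\<close> shows that it is the volume of the ball times the measure of the preimage of
  \<open>A\<close>; translating \<open>x\<close>, and using that \<open>f\<close> maps balls to balls, shows that it is the volume of the ball
  times the measure of \<open>A\<close>.
\<close>

lemma lborel_distr_orthogonal:
  fixes f :: "'a::euclidean_space \<Rightarrow> 'a"
  assumes f: "orthogonal_transformation f"
  shows "distr lborel borel f = lborel"
proof (rule measure_eqI)
  fix A assume "A \<in> sets (distr lborel borel f)"
  then have A[measurable]: "A \<in> sets borel" by simp
  have lin: "linear f" and bij: "bij f" and inv: "orthogonal_transformation (inv f)"
    using f by (auto simp: orthogonal_transformation_linear orthogonal_transformation_bij orthogonal_transformation_inv)
  have [measurable]: "f \<in> borel_measurable borel"
    using lin by (intro borel_measurable_continuous_onI linear_continuous_on) (simp add: linear_conv_bounded_linear)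
  define h :: "'a \<Rightarrow> ennreal" where "h = indicator (cball 0 1)"
  define g :: "'a \<Rightarrow> ennreal" where "g = indicator A"
  have [measurable]: "h \<in> borel_measurable borel" "g \<in> borel_measurable borel"
    unfolding h_def g_def by (auto intro!: borel_measurable_indicator)
  define V where "V = emeasure lborel (cball (0::'a) 1)"
  have V: "V \<noteq> 0" "V \<noteq> top"
    using unit_ball_vol_pos[of "real DIM('a)"] by (auto simp: V_def emeasure_cball simp del: unit_ball_vol_pos)
  have hV: "(\<integral>\<^sup>+x. h x \<partial>lborel) = V"
    by (simp add: h_def V_def)
  have h_sym: "(\<integral>\<^sup>+y. h (x - f y) \<partial>lborel) = V" for x
  proof -
    have "h (x - f y) = indicator (cball (inv f x) 1) y" for y
    proof -
      have "x - f y = f (inv f x - y)"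
        using bij lin by (simp add: linear_diff bij_is_surj surj_f_inv_f)
      then have "norm (x - f y) = norm (inv f x - y)"
        using orthogonal_transformation_norm[OF f] by simp
      then show ?thesis
        unfolding h_def by (simp add: indicator_def dist_norm norm_minus_commute[of "f y"])
    qed
    then have "(\<integral>\<^sup>+y. h (x - f y) \<partial>lborel) = emeasure lborel (cball (inv f x) 1)"
      by simp
    then show ?thesis by (simp add: V_def emeasure_cball)
  qed
  have tr: "(\<integral>\<^sup>+y. g (f y + x) \<partial>lborel) = (\<integral>\<^sup>+y. g (f y) \<partial>lborel)" for x
  proof -
    have "f y + x = f (inv f x + y)" for y
      using bij lin by (simp add: linear_add bij_is_surj surj_f_inv_f)
    then show ?thesis
      using nn_integral_lborel_translate[of "\<lambda>y. g (f y)" "inv f x"] by simp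
  qed
  have "V * (\<integral>\<^sup>+y. g (f y) \<partial>lborel) = (\<integral>\<^sup>+x. h x * (\<integral>\<^sup>+y. g (f y + x) \<partial>lborel) \<partial>lborel)"
    unfolding tr hV[symmetric] by (simp add: nn_integral_multc)
  also have "\<dots> = (\<integral>\<^sup>+x. \<integral>\<^sup>+y. h x * g (f y + x) \<partial>lborel \<partial>lborel)"
    by (simp add: nn_integral_cmult)
  also have "\<dots> = (\<integral>\<^sup>+y. \<integral>\<^sup>+x. h x * g (f y + x) \<partial>lborel \<partial>lborel)"
    by (rule lborel_pair.Fubini') measurable
  also have "\<dots> = (\<integral>\<^sup>+y. \<integral>\<^sup>+x. h (x - f y) * g x \<partial>lborel \<partial>lborel)"
    using nn_integral_lborel_translate[of "\<lambda>x. h (x - f y) * g x" "f y" for y] by simp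
  also have "\<dots> = (\<integral>\<^sup>+x. \<integral>\<^sup>+y. h (x - f y) * g x \<partial>lborel \<partial>lborel)"
    by (rule lborel_pair.Fubini') measurable
  also have "\<dots> = V * (\<integral>\<^sup>+x. g x \<partial>lborel)"
    by (simp add: nn_integral_multc nn_integral_cmult h_sym)
  finally have "(\<integral>\<^sup>+y. g (f y) \<partial>lborel) = (\<integral>\<^sup>+x. g x \<partial>lborel)"
    using V by (simp add: ennreal_mult_cancel_left)
  moreover have "(\<integral>\<^sup>+y. g y \<partial>distr lborel borel f) = (\<integral>\<^sup>+y. g (f y) \<partial>lborel)"
    by (rule nn_integral_distr) simp_all
  moreover have "(\<integral>\<^sup>+y. g y \<partial>distr lborel borel f) = emeasure (distr lborel borel f) A"
    unfolding g_def by (rule nn_integral_indicator) simp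
  moreover have "(\<integral>\<^sup>+y. g y \<partial>lborel) = emeasure lborel A"
    unfolding g_def by (rule nn_integral_indicator) simp
  ultimately show "emeasure (distr lborel borel f) A = emeasure lborel A"
    by simp
qed simp

lemma lborel_integral_orthogonal:
  fixes f :: "'a::euclidean_space \<Rightarrow> 'a" and g :: "'a \<Rightarrow> complex"
  assumes f: "orthogonal_transformation f" and [measurable]: "g \<in> borel_measurable borel"
  shows "(LINT y|lborel. g (f y)) = (LINT y|lborel. g y)"
proof -
  have [measurable]: "f \<in> borel_measurable borel"
    using orthogonal_transformation_linear[OF f]
    by (intro borel_measurable_continuous_onI linear_continuous_on) (simp add: linear_conv_bounded_linear)
  have "(LINT y|distr lborel borel f. g y) = (LINT y|lborel. g (f y))"
    by (rule integral_distr) simp_all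
  then show ?thesis by (simp add: lborel_distr_orthogonal[OF f])
qed

section \<open>The fractional Laplacian as a Riesz potential\<close>

lemma norm_powr_eq_npow: "x \<noteq> 0 \<Longrightarrow> complex_of_real (norm x powr a) = npow (of_real a) x"
  by (simp add: powr_def npow_def flip: exp_of_real)

lemma integrable_npow_fourier_radial:
  fixes z :: complex
  assumes \<eta>: "bump T \<eta>" and z: "0 < Re z + CARD('n)"
  shows "integrable lborel (\<lambda>\<xi>::real^'n. npow z \<xi> * fourier (radial \<eta>) \<xi>)"
proof -
  obtain k :: nat where "(Re z + CARD('n)) / 2 < real k"
    using reals_Archimedean2 by blast
  then have k: "Re z + CARD('n) < real (2 * k)" by simp
  obtain C where C: "\<And>\<xi>::real^'n. norm (fourier (radial \<eta>) \<xi>) \<le> C"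
    "\<And>\<xi>::real^'n. \<xi> \<noteq> 0 \<Longrightarrow> norm (fourier (radial \<eta>) \<xi>) \<le> C * exp (- real (2 * k) * ln (norm \<xi>))"
    using fourier_radial_decay[OF \<eta>, of k] by blast
  show ?thesis
    by (rule integrable_npow_decay[OF _ C]) (use k z in \<open>auto intro!: borel_measurable_fourier borel_measurable_radial[OF \<eta>]\<close>)
qed

lemma bounded_radial:
  assumes \<eta>: "bump T \<eta>"
  obtains C where "\<And>x::'a::real_normed_vector. norm (radial \<eta> x :: complex) \<le> C"
proof -
  have "compact (\<eta> ` {- T..T})"
    by (intro compact_continuous_image bump_continuous[OF \<eta>]) auto
  then obtain C where C: "\<And>t. t \<in> {- T..T} \<Longrightarrow> \<bar>\<eta> t\<bar> \<le> C"
    by (force dest!: compact_imp_bounded simp: bounded_iff)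
  have "\<bar>\<eta> t\<bar> \<le> max C 0" for t
  proof (cases "T < \<bar>t\<bar>")
    case False
    then have "t \<in> {- T..T}" by auto
    from C[OF this] show ?thesis by simp
  qed (use \<eta> in \<open>simp add: bump_def\<close>)
  then have "norm (radial \<eta> x :: complex) \<le> max C 0" for x :: 'a
    by (simp add: radial_def)
  then show ?thesis by (rule that)
qed

lemma fourier_translate:
  fixes f :: "real ^ 'n \<Rightarrow> complex"
  shows "fourier (\<lambda>y. f (x + y)) \<xi> = cis (x \<bullet> \<xi>) * fourier f \<xi>"
proof -
  have "fourier (\<lambda>y. f (x + y)) \<xi> = (LINT y|lborel. cis (x \<bullet> \<xi>) * (f (x + y) * cis (- ((x + y) \<bullet> \<xi>))))"
    unfolding fourier_def
  proof (rule Bochner_Integration.integral_cong[OF refl])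
    fix y
    have "cis (- (y \<bullet> \<xi>)) = cis (x \<bullet> \<xi>) * cis (- ((x + y) \<bullet> \<xi>))"
      by (simp add: cis_mult inner_add_left)
    then show "f (x + y) * cis (- (y \<bullet> \<xi>)) = cis (x \<bullet> \<xi>) * (f (x + y) * cis (- ((x + y) \<bullet> \<xi>)))"
      by (simp only: mult.left_commute)
  qed
  also have "\<dots> = cis (x \<bullet> \<xi>) * fourier f \<xi>"
    using lborel_integral_translate[of "\<lambda>y. f y * cis (- (y \<bullet> \<xi>))" x]
    by (simp add: fourier_def)
  finally show ?thesis .
qed

text \<open>
  The inverse Fourier integral is a Fourier transform at the reflected point, so that the formula for powers of
  the norm can be applied to it.
\<close>

lemma frac_laplacian_eq_fourier:
  "frac_laplacian \<gamma> f x = fourier (\<lambda>\<xi>::real^'n. npow (of_real (2 * \<gamma>)) \<xi> * fourier f \<xi>) (- x) / of_real ((2 * pi) ^ CARD('n))"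
  if [measurable]: "f \<in> borel_measurable borel"
proof -
  have "(LINT \<xi>|lborel. of_real (norm \<xi> powr (2 * \<gamma>)) * fourier f \<xi> * cis (x \<bullet> \<xi>))
      = (LINT \<xi>|lborel. npow (of_real (2 * \<gamma>)) \<xi> * fourier f \<xi> * cis (- (\<xi> \<bullet> - x)))"
  proof (rule integral_cong_AE)
    show "AE \<xi> in lborel. of_real (norm \<xi> powr (2 * \<gamma>)) * fourier f \<xi> * cis (x \<bullet> \<xi>)
        = npow (of_real (2 * \<gamma>)) \<xi> * fourier f \<xi> * cis (- (\<xi> \<bullet> - x))"
      using AE_lborel_singleton[of "0::real^'n"]
      by eventually_elim (simp add: norm_powr_eq_npow inner_commute)
  qed measurable
  then show ?thesis
    unfolding frac_laplacian_def fourier_def[of "\<lambda>\<xi>. npow (of_real (2 * \<gamma>)) \<xi> * fourier f \<xi>"] by simp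
qed

text \<open>
  Up to a constant this is the Riesz potential of order \<open>b + n\<close> of \<open>f\<close> if \<open>- n < b < 0\<close>; more negative exponents \<open>b\<close> occur
  for \<open>x\<close> away from the support of \<open>f\<close>.
\<close>

definition riesz_kernel_integral :: "real \<Rightarrow> (real ^ 'n \<Rightarrow> complex) \<Rightarrow> real ^ 'n \<Rightarrow> complex" where
  "riesz_kernel_integral b f x = (LINT y|lborel. npow (of_real b) (y - x) * f y)"

lemma npow_double_nat: "x \<noteq> 0 \<Longrightarrow> npow (of_nat (2 * m)) x = of_real ((norm x)\<^sup>2 ^ m)"
proof -
  assume x: "x \<noteq> 0"
  have "npow (of_nat (2 * m)) x = exp (of_real (ln (norm x))) ^ (2 * m)"
    unfolding npow_def by (rule exp_of_nat_mult)
  then show ?thesis using x by (simp add: exp_of_real power_mult)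
qed

text \<open>
  The symbol \<open>|\<xi>| powr (2\<gamma>)\<close> is \<open>|\<xi>| powr (- 2\<sigma>)\<close> times \<open>|\<xi>| ^ (2m)\<close> for \<open>\<sigma> = m - \<gamma>\<close>. The second factor is the
  \<open>m\<close>-th power of the Laplacian up to sign, and the first one is turned into a convolution with \<open>|y| powr (2\<sigma> - n)\<close> by
  applying the formula for powers of the norm to a translate. Both exponents are admissible
  because \<open>0 < 2\<sigma> < n\<close>.
\<close>

lemma frac_laplacian_radial_eq_riesz:
  assumes \<eta>: "bump T \<eta>" and m: "\<gamma> < real m" "2 * (real m - \<gamma>) < CARD('n)" "0 < \<gamma>"
  shows "\<exists>R::real. \<forall>x::real^'n. frac_laplacian \<gamma> (radial \<eta>) x
     = of_real R * riesz_kernel_integral (2 * (real m - \<gamma>) - CARD('n)) (radial ((laplacian_profile CARD('n) ^^ m) \<eta>)) x"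
proof -
  define \<sigma> where "\<sigma> = real m - \<gamma>"
  define N where "N = CARD('n)"
  define f where "f = (radial ((laplacian_profile CARD('n) ^^ m) \<eta>) :: real^'n \<Rightarrow> complex)"
  have b: "bump T ((laplacian_profile CARD('n) ^^ m) \<eta>)" by (rule bump_laplacian_power[OF \<eta>])
  have [measurable]: "f \<in> borel_measurable borel" "radial \<eta> \<in> borel_measurable (borel :: (real^'n) measure)"
    unfolding f_def using borel_measurable_radial b \<eta> by auto
  define a where "a = sqrt pi ^ N * exp ((real N - 2 * \<sigma>) * ln 2) * Gamma ((real N - 2 * \<sigma>) / 2)"
  define k where "k = a / Gamma \<sigma>"
  have s: "0 < \<sigma>" "2 * \<sigma> < N" using m by (auto simp: \<sigma>_def N_def)
  have "frac_laplacian \<gamma> (radial \<eta>) x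
      = of_real ((- 1) ^ m * k / (2 * pi) ^ N) * riesz_kernel_integral (2 * \<sigma> - N) f x" for x :: "real^'n"
  proof -
    define h where "h y = f (x + y)" for y
    have h_int: "integrable lborel h"
      unfolding h_def f_def by (rule lborel_integrable_translate[OF integrable_radial[OF b]])
    obtain C where C: "\<And>y::real^'n. norm (f y) \<le> C"
      using bounded_radial[OF b] unfolding f_def by blast
    have h_supp: "h y = 0" if "exp T + norm x < norm y" for y
    proof -
      have "norm y \<le> norm (x + y) + norm x"
        using norm_triangle_ineq4[of "x + y" x] by simp
      then have "x + y \<notin> {y. exp (- T) \<le> norm y \<and> norm y \<le> exp T}" using that by auto
      then show ?thesis unfolding h_def f_def by (rule radial_eq_0_outside[OF b])
    qed
    have A: "integrable lborel (\<lambda>\<xi>. npow (- of_real (2 * \<sigma>)) \<xi> * fourier h \<xi>)"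
    proof -
      have "integrable lborel (\<lambda>\<xi>::real^'n. npow (- of_real (2 * \<sigma>)) \<xi> * fourier f \<xi>)"
        unfolding f_def by (rule integrable_npow_fourier_radial[OF b]) (use s in \<open>simp add: N_def\<close>)
      moreover have "norm (fourier h \<xi>) = norm (fourier f \<xi>)" for \<xi>
        unfolding h_def fourier_translate by (simp add: norm_mult)
      moreover have "h \<in> borel_measurable borel"
        using h_int by auto
      ultimately show ?thesis
        by (elim Bochner_Integration.integrable_bound) (auto simp: norm_mult)
    qed
    have B: "integrable lborel (\<lambda>y. npow (of_real (2 * \<sigma>) - of_nat CARD('n)) y * h y)"
      by (rule integrable_npow_bounded_support[where C = C and R = "exp T + norm x"])
         (use s h_supp C in \<open>auto simp: h_def N_def\<close>)
    have G: "Gamma (complex_of_real \<sigma>) * (LINT \<xi>|lborel. npow (- of_real (2 * \<sigma>)) \<xi> * fourier h \<xi>)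
        = of_real a * (LINT y|lborel. npow (of_real (2 * \<sigma>) - of_nat CARD('n)) y * h y)" (is "_ * ?X = _ * ?Y")
      using integral_npow_fourier[OF h_int _ _ A B] s
      by (simp add: a_def N_def Gamma_complex_of_real[symmetric] exp_of_real[symmetric])
    have "Gamma \<sigma> \<noteq> 0" using Gamma_real_pos[OF s(1)] by (rule less_imp_neq[symmetric])
    then have key: "?X = of_real k * ?Y"
    proof -
      have "complex_of_real (Gamma \<sigma>) * ?X = of_real (Gamma \<sigma>) * (of_real k * ?Y)"
        using G \<open>Gamma \<sigma> \<noteq> 0\<close> by (simp only: Gamma_complex_of_real mult.assoc[symmetric] of_real_mult[symmetric])
          (simp add: k_def)
      then show ?thesis using \<open>Gamma \<sigma> \<noteq> 0\<close> by simp
    qed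
    have pw: "npow (of_real (2 * \<gamma>)) \<xi> * fourier (radial \<eta>) \<xi> * cis (- (\<xi> \<bullet> - x))
        = (- 1) ^ m * (npow (- of_real (2 * \<sigma>)) \<xi> * fourier h \<xi>)" if "\<xi> \<noteq> 0" for \<xi>
    proof -
      have e: "complex_of_real (2 * \<gamma>) = - of_real (2 * \<sigma>) + of_nat (2 * m)"
        by (simp add: \<sigma>_def)
      have "npow (of_real (2 * \<gamma>)) \<xi> = npow (- of_real (2 * \<sigma>)) \<xi> * of_real ((norm \<xi>)\<^sup>2 ^ m)"
        unfolding e npow_add npow_double_nat[OF that] ..
      moreover have "fourier h \<xi> = cis (x \<bullet> \<xi>) * (of_real ((- 1) ^ m * (norm \<xi>)\<^sup>2 ^ m) * fourier (radial \<eta>) \<xi>)"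
        unfolding h_def fourier_translate unfolding f_def fourier_radial_laplacian_power[OF \<eta>] power_minus[of "(norm \<xi>)\<^sup>2"] ..
      moreover have "(- 1 :: complex) ^ m * (- 1) ^ m = 1"
        by (simp flip: power_mult_distrib)
      ultimately show ?thesis
        by (simp add: inner_commute mult_ac)
    qed
    have "fourier (\<lambda>\<xi>. npow (of_real (2 * \<gamma>)) \<xi> * fourier (radial \<eta>) \<xi>) (- x)
        = (LINT \<xi>|lborel. (- 1) ^ m * (npow (- of_real (2 * \<sigma>)) \<xi> * fourier h \<xi>))"
      unfolding fourier_def[of "\<lambda>\<xi>. npow (of_real (2 * \<gamma>)) \<xi> * fourier (radial \<eta>) \<xi>"]
    proof (rule integral_cong_AE)
      have [measurable]: "h \<in> borel_measurable borel" unfolding h_def by measurable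
      show "AE \<xi> in lborel. npow (of_real (2 * \<gamma>)) \<xi> * fourier (radial \<eta>) \<xi> * cis (- (\<xi> \<bullet> - x))
          = (- 1) ^ m * (npow (- of_real (2 * \<sigma>)) \<xi> * fourier h \<xi>)"
        using AE_lborel_singleton[of "0::real^'n"] by eventually_elim (rule pw)
    qed (unfold h_def, measurable)
    also have "\<dots> = (- 1) ^ m * (of_real k * (LINT y|lborel. npow (of_real (2 * \<sigma>) - of_nat CARD('n)) y * h y))"
      unfolding Bochner_Integration.integral_mult_right_zero key ..
    also have "(LINT y|lborel. npow (of_real (2 * \<sigma>) - of_nat CARD('n)) y * h y) = riesz_kernel_integral (2 * \<sigma> - N) f x"
      using lborel_integral_translate[of "\<lambda>y. npow (of_real (2 * \<sigma> - N)) (y - x) * f y" x]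
      by (simp add: riesz_kernel_integral_def h_def N_def)
    finally show ?thesis
      by (simp add: frac_laplacian_eq_fourier N_def)
  qed
  then show ?thesis unfolding f_def \<sigma>_def N_def by blast
qed

lemma riesz_kernel_integral_real:
  "\<exists>r. riesz_kernel_integral b (radial \<eta>) x = of_real r"
proof -
  have "npow (of_real b) (y - x) * radial \<eta> y
      = of_real (exp (b * ln (norm (y - x))) * (if y = 0 then 0 else \<eta> (- ln (norm y))))" for y
    by (simp add: npow_def radial_def flip: exp_of_real)
  then show ?thesis
    unfolding riesz_kernel_integral_def by (simp only: integral_complex_of_real) blast
qed

lemma riesz_kernel_integral_rotate:
  fixes f :: "real ^ 'n \<Rightarrow> real ^ 'n"
  assumes \<eta>: "bump T \<eta>" and f: "orthogonal_transformation f"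
  shows "riesz_kernel_integral b (radial \<eta>) (f x) = riesz_kernel_integral b (radial \<eta>) x"
proof -
  have [measurable]: "radial \<eta> \<in> borel_measurable (borel :: (real^'n) measure)"
    by (rule borel_measurable_radial[OF \<eta>])
  have n: "norm (f y) = norm y" for y
    using f by (rule orthogonal_transformation_norm)
  have diff: "f y - f x = f (y - x)" for y
    using orthogonal_transformation_linear[OF f] by (simp add: linear_diff)
  have "npow (of_real b) (f y - f x) * radial \<eta> (f y) = npow (of_real b) (y - x) * radial \<eta> y" for y
  proof -
    have "f y = 0 \<longleftrightarrow> y = 0" using n[of y] by (metis norm_eq_zero)
    then show ?thesis
      using n[of y] n[of "y - x"] diff[of y] by (simp add: npow_def radial_def)
  qed
  moreover have "(LINT y|lborel. npow (of_real b) (f y - f x) * radial \<eta> (f y)) = riesz_kernel_integral b (radial \<eta>) (f x)"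
    unfolding riesz_kernel_integral_def
    by (rule lborel_integral_orthogonal[OF f]) measurable
  ultimately show ?thesis
    unfolding riesz_kernel_integral_def by simp
qed

text \<open>
  Away from \<open>x\<close> the Laplacian of \<open>|y - x| powr b\<close> is \<open>b (b + n - 2) |y - x| powr (b - 2)\<close>. If \<open>x\<close> lies outside the support of the
  radial function, Green's formula moves the Laplacian onto the kernel.
\<close>

lemma riesz_kernel_integral_laplacian:
  assumes \<eta>: "bump T \<eta>" and x: "exp T < norm (x :: real^'n)"
  shows "riesz_kernel_integral b (radial (laplacian_profile CARD('n) \<eta>)) x
    = of_real (b * (b + CARD('n) - 2)) * riesz_kernel_integral (b - 2) (radial \<eta>) x"
proof -
  let ?K = "{y::real^'n. exp (- T) \<le> norm y \<and> norm y \<le> exp T}"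
  let ?z = "complex_of_real b"
  let ?u = "\<lambda>e y::real^'n. complex_of_real ((y - x) \<bullet> e)"
  define V where "V c y = npow c (y - x)" for c y
  have dV: "((\<lambda>s. V c (y + s *\<^sub>R e)) has_vector_derivative c * ?u e y * V (c - 2) y) (at 0)"
    if "y \<noteq> x" for c y e
    using npow_directional_derivative[of "y - x" c e] that by (simp add: V_def algebra_simps)
  have cV: "continuous_on (- {0, x}) (V c)" for c
    unfolding V_def npow_def by (intro continuous_intros) auto
  have "(LINT y|lborel. V ?z y * radial (laplacian_profile DIM(real^'n) \<eta>) y)
      = (LINT y|lborel. (\<Sum>e\<in>Basis. ?z * (V (?z - 2) y + (?z - 2) * (?u e y)\<^sup>2 * V (?z - 4) y)) * radial \<eta> y)"
  proof (rule radial_Green[OF \<eta>, where S = "- {0, x}" and dU = "\<lambda>e y. ?z * (?u e y * V (?z - 2) y)"])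
    show "?K \<subseteq> - {0, x}"
      using exp_gt_zero[of "- T"] x by (auto simp del: exp_gt_zero)
    fix e y :: "real^'n" assume e: "e \<in> Basis" and y: "y \<in> - {0, x}"
    then have "y \<noteq> x" by simp
    show "((\<lambda>s. V ?z (y + s *\<^sub>R e)) has_vector_derivative ?z * (?u e y * V (?z - 2) y)) (at 0)"
      using dV[OF \<open>y \<noteq> x\<close>, of ?z e] by (simp add: mult.assoc)
    have "((\<lambda>s. (y + s *\<^sub>R e - x) \<bullet> e) has_real_derivative 1) (at 0)"
      using e unfolding inner_add_left inner_diff_left inner_scaleR_left
      by (auto intro!: derivative_eq_intros)
    then have "((\<lambda>s. ?u e (y + s *\<^sub>R e)) has_vector_derivative of_real 1) (at 0)"
      by (rule has_vector_derivative_of_real)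
    from has_vector_derivative_mult_right[OF has_vector_derivative_mult[OF this dV[OF \<open>y \<noteq> x\<close>, of "?z - 2" e]], of ?z]
    show "((\<lambda>s. ?z * (?u e (y + s *\<^sub>R e) * V (?z - 2) (y + s *\<^sub>R e))) has_vector_derivative
        ?z * (V (?z - 2) y + (?z - 2) * (?u e y)\<^sup>2 * V (?z - 4) y)) (at 0)"
      by (simp add: power2_eq_square algebra_simps)
  qed (auto intro!: continuous_intros cV)
  also have "\<dots> = (LINT y|lborel. of_real (b * (b + CARD('n) - 2)) * (V (?z - 2) y * radial \<eta> y))"
  proof (rule Bochner_Integration.integral_cong[OF refl])
    fix y :: "real^'n"
    show "(\<Sum>e\<in>Basis. ?z * (V (?z - 2) y + (?z - 2) * (?u e y)\<^sup>2 * V (?z - 4) y)) * radial \<eta> y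
        = of_real (b * (b + CARD('n) - 2)) * (V (?z - 2) y * radial \<eta> y)"
    proof (cases "y = x")
      case True
      then have "radial \<eta> y = 0"
        using radial_eq_0_outside[OF \<eta>, of y] x by auto
      then show ?thesis by simp
    next
      case False
      have sq: "(norm (y - x))\<^sup>2 = (\<Sum>e\<in>Basis. ((y - x) \<bullet> e)\<^sup>2)"
        unfolding power2_norm_eq_inner by (subst euclidean_inner[of "y - x" "y - x"]) (simp add: power2_eq_square)
      have "V (?z - 2) y = V (?z - 4 + of_nat (2 * 1)) y" by simp
      also have "\<dots> = V (?z - 4) y * of_real ((norm (y - x))\<^sup>2)"
        using npow_double_nat[of "y - x" 1] False unfolding V_def npow_add by simp
      finally have "(\<Sum>e\<in>Basis. (?u e y)\<^sup>2) * V (?z - 4) y = V (?z - 2) y"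
        unfolding sq by (simp add: mult.commute)
      moreover have "(\<Sum>e\<in>Basis. ?z * (V (?z - 2) y + (?z - 2) * (?u e y)\<^sup>2 * V (?z - 4) y))
          = ?z * (of_nat CARD('n) * V (?z - 2) y + (?z - 2) * ((\<Sum>e\<in>Basis. (?u e y)\<^sup>2) * V (?z - 4) y))"
        by (simp add: sum_distrib_left sum_distrib_right sum.distrib mult_ac distrib_left)
      ultimately have "(\<Sum>e\<in>Basis. ?z * (V (?z - 2) y + (?z - 2) * (?u e y)\<^sup>2 * V (?z - 4) y))
          = ?z * (of_nat CARD('n) * V (?z - 2) y + (?z - 2) * V (?z - 2) y)"
        by (simp only:)
      also have "\<dots> = of_real (b * (b + CARD('n) - 2)) * V (?z - 2) y"
        by (simp add: algebra_simps)
      finally show ?thesis by (simp only: mult.assoc)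
    qed
  qed
  finally show ?thesis
    by (simp add: riesz_kernel_integral_def V_def)
qed

lemma riesz_kernel_integral_laplacian_power:
  assumes \<eta>: "bump T \<eta>"
  shows "\<exists>c::real. \<forall>x::real^'n. exp T < norm x \<longrightarrow>
    riesz_kernel_integral b (radial ((laplacian_profile CARD('n) ^^ m) \<eta>)) x = of_real c * riesz_kernel_integral (b - 2 * real m) (radial \<eta>) x"
proof (induction m arbitrary: b)
  case 0
  show ?case by (intro exI[of _ 1]) simp
next
  case (Suc m)
  obtain c where c: "\<And>x::real^'n. exp T < norm x \<Longrightarrow>
      riesz_kernel_integral (b - 2) (radial ((laplacian_profile CARD('n) ^^ m) \<eta>)) x
        = of_real c * riesz_kernel_integral (b - 2 - 2 * real m) (radial \<eta>) x"
    using Suc.IH by blast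
  have e: "b - 2 * real (Suc m) = b - 2 - 2 * real m" by simp
  show ?case
    unfolding e
    by (rule exI[of _ "b * (b + CARD('n) - 2) * c"])
       (simp add: riesz_kernel_integral_laplacian[OF bump_laplacian_power[OF \<eta>]] c)
qed

text \<open>
  On the support of the radial function \<open>|y| \<le> exp T \<le> |x| / 2\<close>, so \<open>|y - x| \<ge> |x| / 2\<close>.
\<close>

lemma norm_riesz_kernel_integral_le:
  assumes \<eta>: "bump T \<eta>" and b: "b \<le> 0" and x: "2 * exp T \<le> norm (x :: real^'n)"
  shows "norm (riesz_kernel_integral b (radial \<eta>) x)
    \<le> exp (b * ln (norm x)) * (exp (- b * ln 2) * (LINT y::real^'n|lborel. norm (radial \<eta> y :: complex)))"
proof -
  have x0: "0 < norm x" using x exp_gt_zero[of T] by linarith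
  have "norm (npow (of_real b) (y - x) * radial \<eta> y) \<le> exp (b * (ln (norm x) - ln 2)) * norm (radial \<eta> y :: complex)" for y :: "real^'n"
  proof (cases "norm y \<le> exp T")
    case True
    have "norm x / 2 \<le> norm (y - x)"
      using norm_triangle_ineq2[of x y] True x by (simp add: norm_minus_commute)
    then have "ln (norm x / 2) \<le> ln (norm (y - x))"
      using x0 by (subst ln_le_cancel_iff) auto
    then have "ln (norm x) - ln 2 \<le> ln (norm (y - x))"
      using x0 by (simp add: ln_div)
    then have "b * ln (norm (y - x)) \<le> b * (ln (norm x) - ln 2)"
      using b by (rule mult_left_mono_neg)
    then show ?thesis
      by (simp add: norm_mult norm_npow mult_right_mono)
  next
    case False
    then show ?thesis using radial_eq_0_outside[OF \<eta>, of y] by simp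
  qed
  then have "(LINT y|lborel. norm (npow (of_real b) (y - x) * radial \<eta> y))
      \<le> (LINT y::real^'n|lborel. exp (b * (ln (norm x) - ln 2)) * norm (radial \<eta> y :: complex))"
    by (intro integral_mono' integrable_mult_right integrable_norm integrable_radial[OF \<eta>]) auto
  then have "norm (riesz_kernel_integral b (radial \<eta>) x)
      \<le> (LINT y::real^'n|lborel. exp (b * (ln (norm x) - ln 2)) * norm (radial \<eta> y :: complex))"
    unfolding riesz_kernel_integral_def by (rule order_trans[OF integral_norm_bound])
  also have "\<dots> = exp (b * ln (norm x)) * (exp (- b * ln 2) * (LINT y::real^'n|lborel. norm (radial \<eta> y :: complex)))"
  proof -
    have "exp (b * (ln (norm x) - ln 2)) = exp (b * ln (norm x)) * exp (- b * ln 2)"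
      unfolding exp_add[symmetric] by (simp add: algebra_simps)
    then show ?thesis by (simp only: Bochner_Integration.integral_mult_right_zero mult.assoc)
  qed
  finally show ?thesis .
qed

section \<open>The fractional Laplacian of a radial function\<close>

text \<open>
  The choice \<open>m = \<lfloor>\<gamma>\<rfloor> + 1\<close> gives \<open>0 < m - \<gamma> \<le> 1\<close>. This is enough when \<open>n \<ge> 3\<close>; when \<open>n = 2\<close> one has \<open>\<gamma> < 1\<close>, so
  \<open>m = 1\<close> and \<open>m - \<gamma> < 1\<close>.
\<close>

lemma exists_riesz_order:
  fixes \<gamma> :: real
  assumes "2 \<le> n" "0 < \<gamma>" "\<gamma> < real n / 2"
  shows "\<exists>m::nat. \<gamma> < real m \<and> 2 * (real m - \<gamma>) < real n"
proof -
  define m where "m = nat \<lfloor>\<gamma>\<rfloor> + 1"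
  have m: "\<gamma> < real m" "real m \<le> \<gamma> + 1"
    using assms by (auto simp: m_def) linarith+
  have "2 * (real m - \<gamma>) < real n"
  proof (cases "n = 2")
    case True
    then have "\<lfloor>\<gamma>\<rfloor> = 0" using assms by (simp add: floor_eq_iff)
    then show ?thesis using assms True by (simp add: m_def)
  next
    case False
    have "2 * (real m - \<gamma>) \<le> 2" using m by simp
    also have "2 < real n" using False assms(1) by simp
    finally show ?thesis .
  qed
  with m show ?thesis by blast
qed

context
  fixes \<gamma> T :: real and \<eta> :: "real \<Rightarrow> real" and g :: "real ^ 'n::finite \<Rightarrow> complex"
  assumes n2: "2 \<le> CARD('n)" and \<gamma>: "0 < \<gamma>" "\<gamma> < real CARD('n) / 2" and \<eta>: "bump T \<eta>"
  defines "g \<equiv> frac_laplacian \<gamma> (radial \<eta>)"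
begin

lemma radial_measurable [measurable]: "(radial \<eta> :: real^'n \<Rightarrow> complex) \<in> borel_measurable borel"
  by (rule borel_measurable_radial[OF \<eta>])

lemma frac_laplacian_radial_measurable [measurable]: "g \<in> borel_measurable borel"
  unfolding g_def frac_laplacian_eq_fourier[OF radial_measurable, abs_def]
  by (intro borel_measurable_divide measurable_compose[OF borel_measurable_uminus borel_measurable_fourier]) measurable

lemma frac_laplacian_radial_real: "\<exists>r. g x = of_real r"
  and frac_laplacian_radial_eq: "norm x = norm y \<Longrightarrow> g x = g y"
  and frac_laplacian_radial_decay:
    "\<exists>C R. \<forall>x. R \<le> norm x \<longrightarrow> norm (g x) \<le> C * exp (- (real CARD('n) + 2 * \<gamma>) * ln (norm x))"
proof -
  obtain m :: nat where m: "\<gamma> < real m" "2 * (real m - \<gamma>) < CARD('n)"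
    using exists_riesz_order[OF n2 \<gamma>] by blast
  define \<eta>' where "\<eta>' = (laplacian_profile CARD('n) ^^ m) \<eta>"
  have \<eta>': "bump T \<eta>'" unfolding \<eta>'_def by (rule bump_laplacian_power[OF \<eta>])
  define b where "b = 2 * (real m - \<gamma>) - CARD('n)"
  obtain R where R: "\<And>x. g x = of_real R * riesz_kernel_integral b (radial \<eta>') x"
    using frac_laplacian_radial_eq_riesz[OF \<eta> m \<gamma>(1)] unfolding g_def b_def \<eta>'_def by blast
  show "\<exists>r. g x = of_real r" for x
    using riesz_kernel_integral_real[of b \<eta>' x] unfolding R by (metis of_real_mult)
  show "g x = g y" if xy: "norm x = norm y" for x y
  proof -
    obtain f :: "real^'n \<Rightarrow> real^'n" where f: "orthogonal_transformation f" "f x = y"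
      by (rule rotation_exists[OF n2 xy])
    show ?thesis
      unfolding R f(2)[symmetric] riesz_kernel_integral_rotate[OF \<eta>' f(1)] ..
  qed
  obtain c where c: "\<And>x::real^'n. exp T < norm x \<Longrightarrow>
      riesz_kernel_integral b (radial \<eta>') x = of_real c * riesz_kernel_integral (b - 2 * real m) (radial \<eta>) x"
    using riesz_kernel_integral_laplacian_power[OF \<eta>, of b m] unfolding \<eta>'_def by blast
  \<comment> \<open>Moving \<open>m\<close> Laplacians onto the kernel lowers its exponent from \<open>2(m - \<gamma>) - n\<close> to \<open>- n - 2\<gamma>\<close>.\<close>
  have e: "b - 2 * real m = - (real CARD('n) + 2 * \<gamma>)" by (simp add: b_def)
  define L where "L = exp ((real CARD('n) + 2 * \<gamma>) * ln 2) * (LINT y::real^'n|lborel. norm (radial \<eta> y :: complex))"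
  have "norm (g x) \<le> \<bar>R\<bar> * \<bar>c\<bar> * L * exp (- (real CARD('n) + 2 * \<gamma>) * ln (norm x))"
    if x: "2 * exp T \<le> norm x" for x
  proof -
    have "exp T < norm x" using x exp_gt_zero[of T] by linarith
    then have "norm (g x) = \<bar>R\<bar> * \<bar>c\<bar> * norm (riesz_kernel_integral (b - 2 * real m) (radial \<eta>) x)"
      unfolding R by (simp add: c norm_mult)
    also have "\<dots> \<le> \<bar>R\<bar> * \<bar>c\<bar> * (exp (- (real CARD('n) + 2 * \<gamma>) * ln (norm x)) * L)"
    proof -
      have "- (real CARD('n) + 2 * \<gamma>) \<le> 0" using \<gamma>(1) by simp
      from norm_riesz_kernel_integral_le[OF \<eta> this x] show ?thesis
        unfolding e L_def minus_minus by (intro mult_left_mono) simp_all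
    qed
    finally show ?thesis by (simp add: mult_ac)
  qed
  then show "\<exists>C R. \<forall>x. R \<le> norm x \<longrightarrow> norm (g x) \<le> C * exp (- (real CARD('n) + 2 * \<gamma>) * ln (norm x))"
    by blast
qed

lemma integrable_npow_frac_laplacian:
  assumes z: "- real CARD('n) < Re z" "Re z < 2 * \<gamma>"
  shows "integrable lborel (\<lambda>x. npow z x * g x)"
proof -
  let ?b = "real CARD('n) + 2 * \<gamma>"
  define C1 where "C1 = (LINT \<xi>::real^'n|lborel. norm (npow (of_real (2 * \<gamma>)) \<xi> * fourier (radial \<eta>) \<xi>))
    / norm (complex_of_real ((2 * pi) ^ CARD('n)))"
  have C1: "norm (g x) \<le> C1" for x
    unfolding g_def frac_laplacian_eq_fourier[OF radial_measurable] norm_divide C1_def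
    by (rule divide_right_mono[OF norm_fourier_le]) simp
  obtain C R where C: "\<And>x. R \<le> norm x \<Longrightarrow> norm (g x) \<le> C * exp (- ?b * ln (norm x))"
    using frac_laplacian_radial_decay by blast
  define C2 where "C2 = max C (C1 * exp (?b * ln (max R 1)))"
  have bound: "norm (g x) \<le> C2 * exp (- ?b * ln (norm x))" if x: "x \<noteq> 0" for x
  proof (cases "R \<le> norm x")
    case True
    have "C * exp (- ?b * ln (norm x)) \<le> C2 * exp (- ?b * ln (norm x))"
      by (rule mult_right_mono) (simp_all add: C2_def)
    then show ?thesis using C[OF True] by linarith
  next
    case False
    then have "ln (norm x) \<le> ln (max R 1)" using x by simp
    then have "0 \<le> ?b * (ln (max R 1) - ln (norm x))"
      using \<gamma> by (intro mult_nonneg_nonneg) auto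
    then have "1 \<le> exp (?b * ln (max R 1)) * exp (- ?b * ln (norm x))"
      unfolding exp_add[symmetric] by (simp add: algebra_simps)
    then have "C1 * 1 \<le> C1 * (exp (?b * ln (max R 1)) * exp (- ?b * ln (norm x)))"
      using order_trans[OF norm_ge_zero C1[of x]] by (intro mult_left_mono)
    also have "\<dots> = (C1 * exp (?b * ln (max R 1))) * exp (- ?b * ln (norm x))"
      by (simp only: mult.assoc)
    also have "\<dots> \<le> C2 * exp (- ?b * ln (norm x))"
      by (rule mult_right_mono) (simp_all add: C2_def)
    finally show ?thesis using C1[of x] by simp
  qed
  show ?thesis
    by (rule integrable_npow_decay[OF frac_laplacian_radial_measurable C1 bound]) (use z in auto)
qed

text \<open>
  The formula for powers of the norm is used twice: with exponent \<open>z\<close> for the inverse Fourier transform in the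
  fractional Laplacian, and with exponent \<open>z' = n - 2\<gamma> - z\<close> for the Fourier transform of the radial function. On the
  line \<open>Re z = n/2 - \<gamma>\<close> the exponent \<open>z'\<close> is the conjugate of \<open>z\<close>, so the Gamma functions combine to squared
  moduli.
\<close>

lemma integral_npow_frac_laplacian:
  fixes \<mu> :: real
  defines "z \<equiv> Complex (real CARD('n) / 2 - \<gamma>) \<mu>"
  shows "(LINT x|lborel. npow (- z) x * g x)
    = of_real (2 powr (2 * \<gamma>) * gamma_ratio (real CARD('n) / 4 + \<gamma> / 2) (real CARD('n) / 4 - \<gamma> / 2) (\<mu> / 2))
      * (LINT x::real^'n|lborel. npow (- (2 * of_real \<gamma> + z)) x * radial \<eta> x)"
proof -
  define N where "N = CARD('n)"
  define p where "p = real N / 4 + \<gamma> / 2"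
  define q where "q = real N / 4 - \<gamma> / 2"
  define G where "G \<xi> = npow (of_real (2 * \<gamma>)) \<xi> * fourier (radial \<eta>) \<xi>" for \<xi> :: "real^'n"
  define z' where "z' = of_nat N - of_real (2 * \<gamma>) - z"
  have q: "0 < q" and p: "0 < p" using \<gamma> by (auto simp: q_def p_def N_def)
  have z'_eq: "z' = cnj z"
    by (simp add: z'_def z_def complex_eq_iff N_def)
  have z: "0 < Re z" "Re z < N" "0 < Re z'" "Re z' < N"
    using \<gamma> by (auto simp: z'_eq z_def N_def)
  have G_int: "integrable lborel G"
    unfolding G_def by (rule integrable_npow_fourier_radial[OF \<eta>]) (use \<gamma> in simp)
  have FG: "fourier G x = of_real ((2 * pi) ^ N) * g x" for x
  proof -
    have "g x = g (- x)" by (rule frac_laplacian_radial_eq) simp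
    also have "\<dots> = fourier G x / of_real ((2 * pi) ^ N)"
      unfolding g_def frac_laplacian_eq_fourier[OF radial_measurable] G_def[abs_def] N_def by simp
    finally show ?thesis by simp
  qed
  have e1: "npow (z - of_nat N) \<xi> * G \<xi> = npow (- z') \<xi> * fourier (radial \<eta>) \<xi>" for \<xi>
  proof -
    have "- z' = (z - of_nat N) + of_real (2 * \<gamma>)" by (simp add: z'_def)
    then show ?thesis unfolding G_def by (simp only: npow_add mult.assoc)
  qed
  have e2: "z' - of_nat N = - (2 * of_real \<gamma> + z)" by (simp add: z'_def)
  have A1: "integrable lborel (\<lambda>x. npow (- z) x * fourier G x)"
    unfolding FG mult.left_commute[of "npow _ _"]
    by (intro integrable_mult_right integrable_npow_frac_laplacian) (use z \<gamma> in \<open>auto simp: N_def\<close>)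
  have A2: "integrable lborel (\<lambda>\<xi>::real^'n. npow (- z') \<xi> * fourier (radial \<eta>) \<xi>)"
    by (rule integrable_npow_fourier_radial[OF \<eta>]) (use z in \<open>simp add: N_def\<close>)
  obtain C where C: "\<And>x::real^'n. norm (radial \<eta> x :: complex) \<le> C"
    using bounded_radial[OF \<eta>] by blast
  have B2: "integrable lborel (\<lambda>y::real^'n. npow (z' - of_nat N) y * radial \<eta> y)"
  proof (rule integrable_npow_bounded_support[OF radial_measurable C])
    show "radial \<eta> y = (0 :: complex)" if "exp T < norm y" for y :: "real^'n"
      by (rule radial_eq_0_outside[OF \<eta>]) (use that in auto)
  qed (use z in \<open>simp add: N_def\<close>)
  have K1: "Gamma (z / 2) * (LINT x|lborel. npow (- z) x * fourier G x)
    = of_real (sqrt pi ^ N) * exp ((of_nat N - z) * of_real (ln 2))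
        * Gamma ((of_nat N - z) / 2) * (LINT \<xi>::real^'n|lborel. npow (- z') \<xi> * fourier (radial \<eta>) \<xi>)"
    using integral_npow_fourier[OF G_int _ _ A1] z A2 unfolding N_def[symmetric] e1 by blast
  have K2: "Gamma (z' / 2) * (LINT \<xi>::real^'n|lborel. npow (- z') \<xi> * fourier (radial \<eta>) \<xi>)
    = of_real (sqrt pi ^ N) * exp ((of_nat N - z') * of_real (ln 2))
        * Gamma ((of_nat N - z') / 2) * (LINT y::real^'n|lborel. npow (- (2 * of_real \<gamma> + z)) y * radial \<eta> y)"
    using integral_npow_fourier[OF integrable_radial[OF \<eta>] _ _ A2] z B2 unfolding N_def[symmetric] e2 by blast
  define X where "X = (LINT x|lborel. npow (- z) x * g x)"
  define Y where "Y = (LINT y::real^'n|lborel. npow (- (2 * of_real \<gamma> + z)) y * radial \<eta> y)"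
  define M where "M = (LINT \<xi>::real^'n|lborel. npow (- z') \<xi> * fourier (radial \<eta>) \<xi>)"
  have X: "(LINT x|lborel. npow (- z) x * fourier G x) = of_real ((2 * pi) ^ N) * X"
    unfolding FG X_def mult.left_commute[of "npow _ _"] by (rule Bochner_Integration.integral_mult_right_zero)
  have gq: "Gamma (z / 2) * Gamma (z' / 2) = of_real ((cmod (Gamma (Complex q (\<mu> / 2))))\<^sup>2)"
  proof -
    have "z / 2 = Complex q (\<mu> / 2)" "z' / 2 = cnj (Complex q (\<mu> / 2))"
      unfolding z'_eq by (simp_all add: z_def q_def complex_eq_iff N_def)
    then show ?thesis by (simp only: cnj_Gamma[symmetric] complex_norm_square)
  qed
  have gp: "Gamma ((of_nat N - z) / 2) * Gamma ((of_nat N - z') / 2) = of_real ((cmod (Gamma (Complex p (\<mu> / 2))))\<^sup>2)"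
  proof -
    have "(of_nat N - z) / 2 = cnj (Complex p (\<mu> / 2))" "(of_nat N - z') / 2 = Complex p (\<mu> / 2)"
      unfolding z'_eq by (simp_all add: z_def p_def complex_eq_iff N_def)
    then show ?thesis by (simp only: cnj_Gamma[symmetric] complex_norm_square mult.commute)
  qed
  have const: "of_real (sqrt pi ^ N) * exp ((of_nat N - z) * of_real (ln 2))
      * (of_real (sqrt pi ^ N) * exp ((of_nat N - z') * of_real (ln 2)))
      = complex_of_real ((2 * pi) ^ N) * of_real (2 powr (2 * \<gamma>))"
  proof -
    have "(of_nat N - z) + (of_nat N - z') = of_real (real N + 2 * \<gamma>)" by (simp add: z'_def)
    then have "exp ((of_nat N - z) * of_real (ln 2)) * exp ((of_nat N - z') * of_real (ln 2))
        = complex_of_real (exp ((real N + 2 * \<gamma>) * ln 2))"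
      by (simp only: exp_add[symmetric] distrib_right[symmetric] of_real_mult[symmetric] exp_of_real)
    also have "exp ((real N + 2 * \<gamma>) * ln 2) = 2 ^ N * 2 powr (2 * \<gamma>)"
      by (simp add: distrib_right exp_add exp_of_nat_mult powr_def)
    finally have "exp ((of_nat N - z) * of_real (ln 2)) * exp ((of_nat N - z') * of_real (ln 2))
        = complex_of_real (2 ^ N * 2 powr (2 * \<gamma>))" .
    moreover have "sqrt pi ^ N * sqrt pi ^ N = pi ^ N"
      by (simp flip: power_mult_distrib)
    then have "complex_of_real (sqrt pi ^ N) * of_real (sqrt pi ^ N) = of_real (pi ^ N)"
      by (simp only: of_real_mult[symmetric])
    ultimately have "(complex_of_real (sqrt pi ^ N) * of_real (sqrt pi ^ N))
        * (exp ((of_nat N - z) * of_real (ln 2)) * exp ((of_nat N - z') * of_real (ln 2)))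
      = of_real (pi ^ N) * of_real (2 ^ N * 2 powr (2 * \<gamma>))" by (simp only:)
    then show ?thesis by (simp add: power_mult_distrib mult_ac)
  qed
  have "of_real ((2 * pi) ^ N) * ((Gamma (z / 2) * Gamma (z' / 2)) * X)
      = Gamma (z' / 2) * (Gamma (z / 2) * (of_real ((2 * pi) ^ N) * X))"
    by (simp only: mult_ac)
  also have "\<dots> = of_real (sqrt pi ^ N) * exp ((of_nat N - z) * of_real (ln 2))
        * Gamma ((of_nat N - z) / 2) * (Gamma (z' / 2) * M)"
    unfolding K1[unfolded X] M_def by (simp only: mult_ac)
  also have "\<dots> = (of_real (sqrt pi ^ N) * exp ((of_nat N - z) * of_real (ln 2))
      * (of_real (sqrt pi ^ N) * exp ((of_nat N - z') * of_real (ln 2))))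
      * (Gamma ((of_nat N - z) / 2) * Gamma ((of_nat N - z') / 2)) * Y"
    unfolding K2[folded M_def Y_def] by (simp only: mult_ac)
  also have "\<dots> = of_real ((2 * pi) ^ N) * (of_real (2 powr (2 * \<gamma>)) * of_real ((cmod (Gamma (Complex p (\<mu> / 2))))\<^sup>2) * Y)"
    unfolding const gp by (simp only: mult.assoc)
  finally have "of_real ((cmod (Gamma (Complex q (\<mu> / 2))))\<^sup>2) * X
      = of_real (2 powr (2 * \<gamma>)) * of_real ((cmod (Gamma (Complex p (\<mu> / 2))))\<^sup>2) * Y"
    unfolding gq by simp
  moreover have "cmod (Gamma (Complex q (\<mu> / 2))) \<noteq> 0"
    using Gamma_Complex_nonzero[OF q] by simp
  ultimately have "X = of_real (2 powr (2 * \<gamma>) * gamma_ratio p q (\<mu> / 2)) * Y"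
    unfolding gamma_ratio_def by (simp add: divide_simps mult_ac)
  then show ?thesis unfolding X_def Y_def p_def q_def N_def .
qed

end

section \<open>The Fourier multiplier of the operator on the cylinder\<close>

lemma cyl_to_space_eq_radial:
  "cyl_to_space \<gamma> (\<lambda>s _. complex_of_real (\<phi> s))
     = (radial (\<lambda>t. exp ((real CARD('n) / 2 - \<gamma>) * t) * \<phi> t) :: real^'n \<Rightarrow> complex)"
proof
  fix x :: "real^'n"
  have "- ((real CARD('n) - 2 * \<gamma>) / 2) * ln (norm x) = (real CARD('n) / 2 - \<gamma>) * - ln (norm x)"
    by (simp add: field_simps)
  then show "cyl_to_space \<gamma> (\<lambda>s _. complex_of_real (\<phi> s)) x
      = radial (\<lambda>t. exp ((real CARD('n) / 2 - \<gamma>) * t) * \<phi> t) x"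
    unfolding cyl_to_space_def radial_def powr_def by simp
qed

text \<open>
  Polar coordinates turn \<open>integral_npow_frac_laplacian\<close> into an identity on the line: \<open>|x| powr (-z)\<close>, the density \<open>exp (- n t)\<close> and the
  weights that relate functions on the cylinder to functions on the space combine to \<open>exp (i \<mu> t)\<close> on both
  sides, and the constant from the polar coordinates cancels.
\<close>

lemma P0_Fourier_multiplier:
  fixes \<phi> :: "real \<Rightarrow> real"
  assumes n2: "2 \<le> CARD('n::finite)" and \<gamma>: "0 < \<gamma>" "\<gamma> < real CARD('n) / 2" and \<phi>: "test_function \<phi>"
  shows "integrable lborel (\<lambda>t. exp (\<i> * of_real (\<mu> * t)) * of_real (P0 TYPE('n) \<gamma> \<phi> t))"
    and "(LINT t|lborel. exp (\<i> * of_real (\<mu> * t)) * of_real (P0 TYPE('n) \<gamma> \<phi> t))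
      = of_real (2 powr (2 * \<gamma>) * gamma_ratio (real CARD('n) / 4 + \<gamma> / 2) (real CARD('n) / 4 - \<gamma> / 2) (\<mu> / 2))
        * (LINT t|lborel. exp (\<i> * of_real (\<mu> * t)) * of_real (\<phi> t))"
proof -
  obtain T where T: "bump T \<phi>" by (rule test_function_imp_bump[OF \<phi>])
  let ?N = "real CARD('n)"
  define \<eta> where "\<eta> t = exp ((?N / 2 - \<gamma>) * t) * \<phi> t" for t
  have \<eta>: "bump T \<eta>" unfolding \<eta>_def[abs_def] by (rule bump_exp_mult[OF T])
  define g where "g = (frac_laplacian \<gamma> (radial \<eta>) :: real^'n \<Rightarrow> complex)"
  note g_meas = frac_laplacian_radial_measurable[OF n2 \<gamma> \<eta>, folded g_def]
  define e0 :: "real^'n" where "e0 = (SOME b. b \<in> Basis)"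
  have e0: "norm e0 = 1" unfolding e0_def by (rule norm_Basis[OF SOME_Basis])
  \<comment> \<open>The fractional Laplacian is radial, so its values along one ray determine it.\<close>
  define u where "u t = Re (g (exp (- t) *\<^sub>R e0))" for t
  have g: "g x = of_real (u (- ln (norm x)))" if "x \<noteq> 0" for x
  proof -
    have "norm (exp (- (- ln (norm x))) *\<^sub>R e0) = norm x"
      using that e0 by simp
    then have eq: "g (exp (- (- ln (norm x))) *\<^sub>R e0) = g x"
      unfolding g_def by (rule frac_laplacian_radial_eq[OF n2 \<gamma> \<eta>])
    obtain r where "g x = of_real r"
      using frac_laplacian_radial_real[OF n2 \<gamma> \<eta>] unfolding g_def by blast
    then show ?thesis unfolding u_def eq by simp
  qed
  have u_meas [measurable]: "u \<in> borel_measurable borel"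
    unfolding u_def using g_meas by measurable
  have \<phi>_meas [measurable]: "\<phi> \<in> borel_measurable borel"
    by (intro borel_measurable_continuous_onI bump_continuous[OF T])
  have P0: "P0 TYPE('n) \<gamma> \<phi> t = exp (- (?N / 2 + \<gamma>) * t) * u t" for t
  proof -
    have *: "P_cyl \<gamma> (\<lambda>s _. complex_of_real (\<phi> s)) t \<theta> = of_real (exp (- (?N / 2 + \<gamma>) * t) * u t)"
      if "\<theta> \<in> sphere 0 1" for \<theta> :: "real^'n"
    proof -
      have "exp (- t) *\<^sub>R \<theta> \<noteq> 0" "norm (exp (- t) *\<^sub>R \<theta>) = exp (- t)"
        using that by auto
      then have "g (exp (- t) *\<^sub>R \<theta>) = of_real (u t)"
        using g[of "exp (- t) *\<^sub>R \<theta>"] by simp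
      moreover have "exp (- t) powr ((?N + 2 * \<gamma>) / 2) = exp (- (?N / 2 + \<gamma>) * t)"
        by (simp add: powr_def field_simps)
      ultimately show ?thesis
        unfolding P_cyl_def cyl_to_space_eq_radial \<eta>_def[abs_def, symmetric] g_def by simp
    qed
    show ?thesis
      unfolding P0_def
    proof (rule the_equality)
      fix v assume "\<forall>\<theta>::real^'n\<in>sphere 0 1. P_cyl \<gamma> (\<lambda>s _. complex_of_real (\<phi> s)) t \<theta> = complex_of_real v"
      then have "P_cyl \<gamma> (\<lambda>s _. complex_of_real (\<phi> s)) t e0 = complex_of_real v"
        using e0 by simp
      then show "v = exp (- (?N / 2 + \<gamma>) * t) * u t"
        using *[of e0] e0 by (simp only: of_real_eq_iff mem_sphere_0 refl)
    qed (use * in blast)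
  qed
  define z where "z = Complex (?N / 2 - \<gamma>) \<mu>"
  have z: "z = of_real (?N / 2 - \<gamma>) + \<i> * of_real \<mu>"
    by (simp add: z_def complex_eq_iff)
  define F where "F t = exp (z * of_real t) * of_real (u t)" for t
  define F' where "F' t = exp ((2 * of_real \<gamma> + z) * of_real t) * of_real (\<eta> t)" for t
  have [measurable]: "F \<in> borel_measurable borel" "F' \<in> borel_measurable borel"
    unfolding F_def F'_def \<eta>_def by measurable
  have npow_neg: "npow (- c) x = exp (c * of_real (- ln (norm x)))" for c and x :: "real^'n"
    by (simp add: npow_def)
  have F: "AE x in lborel. npow (- z) x * g x = F (- ln (norm x))"
    using AE_lborel_singleton[of "0::real^'n"] by eventually_elim (simp only: npow_neg g F_def not_False_eq_True)
  have F': "AE x in lborel. npow (- (2 * of_real \<gamma> + z)) x * radial \<eta> x = F' (- ln (norm (x :: real^'n)))"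
    using AE_lborel_singleton[of "0::real^'n"] by eventually_elim (simp only: npow_neg radial_def F'_def if_False)
  have eF: "of_real (exp (- ?N * t)) * F t = exp (\<i> * of_real (\<mu> * t)) * of_real (P0 TYPE('n) \<gamma> \<phi> t)" for t
  proof -
    have "of_real (- ?N * t) + z * of_real t = \<i> * of_real (\<mu> * t) + of_real (- (?N / 2 + \<gamma>) * t)"
      unfolding z by (simp add: algebra_simps)
    then have "exp (of_real (- ?N * t)) * exp (z * of_real t) = exp (\<i> * of_real (\<mu> * t)) * exp (of_real (- (?N / 2 + \<gamma>) * t))"
      by (simp only: exp_add[symmetric])
    then show ?thesis
      unfolding F_def P0 by (simp only: mult.assoc[symmetric] exp_of_real of_real_mult[of "exp _"])
  qed
  have eF': "of_real (exp (- ?N * t)) * F' t = exp (\<i> * of_real (\<mu> * t)) * of_real (\<phi> t)" for t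
  proof -
    have "of_real (- ?N * t) + (2 * of_real \<gamma> + z) * of_real t + of_real ((?N / 2 - \<gamma>) * t) = \<i> * of_real (\<mu> * t)"
      unfolding z by (simp add: algebra_simps)
    then have "exp (of_real (- ?N * t)) * exp ((2 * of_real \<gamma> + z) * of_real t) * exp (of_real ((?N / 2 - \<gamma>) * t))
        = exp (\<i> * of_real (\<mu> * t))"
      by (simp only: exp_add[symmetric])
    then show ?thesis
      unfolding F'_def \<eta>_def by (simp only: mult.assoc[symmetric] exp_of_real of_real_mult[of "exp _"])
  qed
  have "integrable lborel (\<lambda>x. npow (- z) x * g x)"
    unfolding g_def by (rule integrable_npow_frac_laplacian[OF n2 \<gamma> \<eta>]) (use \<gamma> in \<open>simp_all add: z_def\<close>)
  then have int: "integrable lborel (\<lambda>x::real^'n. F (- ln (norm x)))"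
    by (rule integrable_cong_AE_imp) (use F in \<open>auto elim: eventually_mono\<close>)
  then show "integrable lborel (\<lambda>t. exp (\<i> * of_real (\<mu> * t)) * of_real (P0 TYPE('n) \<gamma> \<phi> t))"
    by (subst (asm) integrable_radial_iff) (simp_all add: eF[simplified])
  let ?K = "complex_of_real (real DIM(real^'n) * unit_ball_vol (real DIM(real^'n)))"
  let ?\<Theta> = "complex_of_real (2 powr (2 * \<gamma>) * gamma_ratio (?N / 4 + \<gamma> / 2) (?N / 4 - \<gamma> / 2) (\<mu> / 2))"
  have "(LINT x|lborel. npow (- z) x * g x) = (LINT x::real^'n|lborel. F (- ln (norm x)))"
    by (rule integral_cong_AE) (use F g_meas in auto)
  also have "\<dots> = ?K * (LINT t|lborel. exp (\<i> * of_real (\<mu> * t)) * of_real (P0 TYPE('n) \<gamma> \<phi> t))"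
    by (subst integral_radial) (simp_all add: eF[simplified])
  finally have L: "(LINT x|lborel. npow (- z) x * g x)
      = ?K * (LINT t|lborel. exp (\<i> * of_real (\<mu> * t)) * of_real (P0 TYPE('n) \<gamma> \<phi> t))" .
  have "(LINT x::real^'n|lborel. npow (- (2 * of_real \<gamma> + z)) x * radial \<eta> x) = (LINT x::real^'n|lborel. F' (- ln (norm x)))"
  proof (rule integral_cong_AE)
    have [measurable]: "(radial \<eta> :: real^'n \<Rightarrow> complex) \<in> borel_measurable borel"
      by (rule borel_measurable_radial[OF \<eta>])
    show "(\<lambda>x::real^'n. npow (- (2 * of_real \<gamma> + z)) x * radial \<eta> x) \<in> borel_measurable lborel"
      by measurable
  qed (use F' in auto)
  also have "\<dots> = ?K * (LINT t|lborel. exp (\<i> * of_real (\<mu> * t)) * of_real (\<phi> t))"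
    by (subst integral_radial) (simp_all add: eF'[simplified])
  finally have R: "(LINT x::real^'n|lborel. npow (- (2 * of_real \<gamma> + z)) x * radial \<eta> x)
      = ?K * (LINT t|lborel. exp (\<i> * of_real (\<mu> * t)) * of_real (\<phi> t))" .
  have "0 < real DIM(real^'n) * unit_ball_vol (real DIM(real^'n))" by simp
  then have K: "?K \<noteq> 0" by (simp only: of_real_eq_0_iff)
  have "?K * (LINT t|lborel. exp (\<i> * of_real (\<mu> * t)) * of_real (P0 TYPE('n) \<gamma> \<phi> t))
      = ?K * (?\<Theta> * (LINT t|lborel. exp (\<i> * of_real (\<mu> * t)) * of_real (\<phi> t)))"
    using integral_npow_frac_laplacian[OF n2 \<gamma> \<eta>, of \<mu>, folded z_def g_def]
    unfolding L R by (simp only: mult.left_commute)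
  then show "(LINT t|lborel. exp (\<i> * of_real (\<mu> * t)) * of_real (P0 TYPE('n) \<gamma> \<phi> t))
      = ?\<Theta> * (LINT t|lborel. exp (\<i> * of_real (\<mu> * t)) * of_real (\<phi> t))"
    using K by (simp only: mult_cancel_left simp_thms)
qed

lemma smooth_cos: "smooth (\<lambda>t. cos (\<mu> * t))"
proof (rule smooth_coinduct[where P = "\<lambda>f. \<exists>a b. f = (\<lambda>t. a * cos (\<mu> * t) + b * sin (\<mu> * t))"])
  show "\<exists>a b. (\<lambda>t. cos (\<mu> * t)) = (\<lambda>t. a * cos (\<mu> * t) + b * sin (\<mu> * t))"
    by (intro exI[of _ 1] exI[of _ 0]) simp
  fix f assume "\<exists>a b. f = (\<lambda>t. a * cos (\<mu> * t) + b * sin (\<mu> * t))"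
  then obtain a b where f: "f = (\<lambda>t. a * cos (\<mu> * t) + b * sin (\<mu> * t))" by blast
  have "DERIV f t :> (b * \<mu>) * cos (\<mu> * t) + (- a * \<mu>) * sin (\<mu> * t)" for t
    unfolding f by (auto intro!: derivative_eq_intros)
  then show "\<exists>g. (\<exists>a b. g = (\<lambda>t. a * cos (\<mu> * t) + b * sin (\<mu> * t))) \<and> (\<forall>t. DERIV f t :> g t)"
    by blast
qed

text \<open>
  The real part of the multiplier identity at \<open>\<mu> = sqrt l\<close>, where the equation for \<open>l\<close> says that the symbol equals the
  constant of the linearized equation.
\<close>

lemma linearized_solution_cos:
  assumes n2: "2 \<le> CARD('n::finite)" and \<gamma>: "0 < \<gamma>" "\<gamma> < real CARD('n) / 2"
    and l: "gamma_equation CARD('n) \<gamma> l"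
  shows "linearized_solution TYPE('n) \<gamma> (\<lambda>t. cos (sqrt l * t))"
proof -
  let ?N = "real CARD('n)"
  let ?c = "c_const CARD('n) \<gamma> * ((?N + 2 * \<gamma>) / (?N - 2 * \<gamma>))"
  let ?\<mu> = "sqrt l"
  define \<Theta> where "\<Theta> = 2 powr (2 * \<gamma>) * gamma_ratio (?N / 4 + \<gamma> / 2) (?N / 4 - \<gamma> / 2) (?\<mu> / 2)"
  have c: "?c = \<Theta>"
    using l unfolding gamma_equation_def c_const_def \<Theta>_def gamma_ratio_def
    by (simp only: power_divide power2_abs mult_ac)
  have Re: "Re (exp (\<i> * of_real (?\<mu> * t)) * of_real r) = cos (?\<mu> * t) * r" for t r
    by (simp add: Re_exp)
  have "P0_dual TYPE('n) \<gamma> (\<lambda>t. cos (?\<mu> * t)) (\<lambda>t. ?c * cos (?\<mu> * t))"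
    unfolding P0_dual_def
  proof (intro allI impI conjI)
    fix \<phi> assume \<phi>: "test_function \<phi>"
    then obtain T where T: "bump T \<phi>" by (rule test_function_imp_bump)
    note M = P0_Fourier_multiplier[OF n2 \<gamma> \<phi>, of ?\<mu>]
    have i\<phi>: "integrable lborel (\<lambda>t. exp (\<i> * of_real (?\<mu> * t)) * of_real (\<phi> t))"
    proof (rule integrable_continuous_bounded_support)
      show "continuous_on UNIV (\<lambda>t. exp (\<i> * of_real (?\<mu> * t)) * complex_of_real (\<phi> t))"
        by (intro continuous_intros bump_continuous[OF T])
    qed (use T in \<open>auto simp: bump_def\<close>)
    show "integrable lborel (\<lambda>t. cos (?\<mu> * t) * P0 TYPE('n) \<gamma> \<phi> t)"
      using integrable_Re[OF M(1)] unfolding Re .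
    have cos_\<phi>: "integrable lborel (\<lambda>t. cos (?\<mu> * t) * \<phi> t)"
      using integrable_Re[OF i\<phi>] unfolding Re .
    then show "integrable lborel (\<lambda>t. ?c * cos (?\<mu> * t) * \<phi> t)"
      unfolding mult.assoc by (intro integrable_mult_right)
    have "(LINT t|lborel. cos (?\<mu> * t) * P0 TYPE('n) \<gamma> \<phi> t)
        = Re (LINT t|lborel. exp (\<i> * of_real (?\<mu> * t)) * of_real (P0 TYPE('n) \<gamma> \<phi> t))"
      unfolding integral_Re[OF M(1), symmetric] Re ..
    also have "\<dots> = \<Theta> * Re (LINT t|lborel. exp (\<i> * of_real (?\<mu> * t)) * of_real (\<phi> t))"
      unfolding M(2) \<Theta>_def by (simp only: Re_complex_of_real Im_complex_of_real complex.sel times_complex.sel mult_zero_left diff_zero)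
    also have "\<dots> = \<Theta> * (LINT t|lborel. cos (?\<mu> * t) * \<phi> t)"
      unfolding integral_Re[OF i\<phi>, symmetric] Re ..
    also have "\<dots> = (LINT t|lborel. ?c * cos (?\<mu> * t) * \<phi> t)"
      unfolding c mult.assoc by (rule Bochner_Integration.integral_mult_right_zero[symmetric])
    finally show "(LINT t|lborel. ?c * cos (?\<mu> * t) * \<phi> t) = (LINT t|lborel. cos (?\<mu> * t) * P0 TYPE('n) \<gamma> \<phi> t)" ..
  qed
  moreover have "bounded (range (\<lambda>t. cos (?\<mu> * t)))"
    by (auto simp: bounded_iff intro!: exI[of _ 1])
  ultimately show ?thesis
    unfolding linearized_solution_def using smooth_cos by blast
qed

theorem theorem1p3:
  assumes "CARD('n::finite) \<ge> 2"
  shows "(\<forall>\<gamma>::real. 0 < \<gamma> \<and> \<gamma> < real CARD('n) / 2 \<longrightarrow>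
            (\<exists>!l. 0 < l \<and> gamma_equation CARD('n) \<gamma> l) \<and>
            (\<exists>v. linearized_solution TYPE('n) \<gamma> v \<and> (\<exists>t. v t \<noteq> 0) \<and>
                 (\<forall>t. v (t + period CARD('n) \<gamma>) = v t))) \<and>
         (CARD('n) \<ge> 3 \<longrightarrow>
            (period CARD('n) \<longlongrightarrow> period CARD('n) 1) (at 1) \<and>
            period CARD('n) 1 = 2 * pi / sqrt (real CARD('n) - 2))"
proof (intro conjI allI impI)
  fix \<gamma> :: real
  assume "0 < \<gamma> \<and> \<gamma> < real CARD('n) / 2"
  then have \<gamma>: "0 < \<gamma>" "\<gamma> < real CARD('n) / 2" by auto
  show "\<exists>!l. 0 < l \<and> gamma_equation CARD('n) \<gamma> l"
    by (rule ex1_gamma_equation[OF \<gamma>])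
  define l where "l = lambda_sol CARD('n) \<gamma>"
  have l: "0 < l" "gamma_equation CARD('n) \<gamma> l"
    unfolding l_def by (rule lambda_sol[OF \<gamma>])+
  show "\<exists>v. linearized_solution TYPE('n) \<gamma> v \<and> (\<exists>t. v t \<noteq> 0) \<and> (\<forall>t. v (t + period CARD('n) \<gamma>) = v t)"
  proof (intro exI conjI allI)
    show "linearized_solution TYPE('n) \<gamma> (\<lambda>t. cos (sqrt l * t))"
      by (rule linearized_solution_cos[OF assms \<gamma> l(2)])
    show "cos (sqrt l * 0) \<noteq> 0" by simp
    show "cos (sqrt l * (t + period CARD('n) \<gamma>)) = cos (sqrt l * t)" for t
      using l(1) by (simp add: period_def flip: l_def) (simp add: distrib_left)
  qed
next
  assume n: "3 \<le> CARD('n)"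
  show "(period CARD('n) \<longlongrightarrow> period CARD('n) 1) (at 1)" "period CARD('n) 1 = 2 * pi / sqrt (real CARD('n) - 2)"
    using tendsto_period_1[OF n] by auto
qed

end
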